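(* Assume that $g$ and $f^*$ are strongly convex with moduli $\gamma_g>0$ and $\gamma_f>0$, respectively. Let $\{(z_n,x_n,y_n): n\ge1\}$ be the sequence generated by the GRPDA with linesearch for the strongly convex case (defined in the context). Then: (a) $\{(z_n,y_n): n\ge1\}$ converges to $(\bar x,\bar y)$, where $\bar x$ and $\bar y$ are the unique primal and dual optimal solutions; (b) there exist constants $C_1,C_2>0$ and $\theta>1$ such that for all $n\ge1$, $\|z_{n+2}-\bar x\|\le C_1/\theta^n$ and $\|y_n-\bar y\|\le C_2/\theta^n$; (c) there exist constants $C_3>0$ and $\hat\theta>1$ such that for all $N\ge1$, $\min_{1\le n\le N}G(x_n,y_n)\le C_3/\hat\theta^N$.
   Context: Setting. $\mathbb{R}^p,\mathbb{R}^q$ are finite-dimensional Euclidean spaces with inner product $\langle\cdot,\cdot\rangle$ and induced norm $\|\cdot\|$; $f:\mathbb{R}^p\to(-\infty,+\infty]$ and $g:\mathbb{R}^q\to(-\infty,+\infty]$ are closed proper convex functions; $K\in\mathbb{R}^{p\times q}$ is a linear map from $\mathbb{R}^q$ to $\mathbb{R}^p$ with adjoint $K^\top$; $f^*(y)=\sup_{x}\{\langle y,x\rangle-f(x)\}$ is the Legendre-Fenchel conjugate. Put $\mathcal{L}(x,y)=g(x)+\langle Kx,y\rangle-f^*(y)$. Standing assumption: the set of minimizers of the primal problem $\min_{x\in\mathbb{R}^q} g(x)+f(Kx)$ is nonempty, and there is $\tilde x\in \mathrm{ri}(\mathrm{dom}(g))$ with $K\tilde x\in \mathrm{ri}(\mathrm{dom}(f))$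 (ri denotes relative interior, dom the effective domain). The dual problem is $\max_{y\in\mathbb{R}^p}-f^*(y)-g^*(-K^\top y)$. The solution set of the saddle point problem $\min_x\max_y\mathcal{L}(x,y)$ is $\Omega=\{(\bar x,\bar y)\in\mathbb{R}^q\times\mathbb{R}^p: 0\in\partial g(\bar x)+K^\top\bar y,\ 0\in\partial f^*(\bar y)-K\bar x\}$; under the strong convexity hypotheses it is a single point $(\bar x,\bar y)$, with $\bar x$ the primal and $\bar y$ the dual optimal solution. The primal-dual gap function is $G(x,y)=\mathcal{L}(x,\bar y)-\mathcal{L}(\bar x,y)=P(x)+D(y)\ge0$, where $P(x)=g(x)-g(\bar x)+\langle K^\top\bar y,x-\bar x\rangle$ and $D(y)=f^*(y)-f^*(\bar y)-\langle K\bar x,y-\bar y\rangle$. A closed proper convex function $h$ is strongly convex with modulus $\gamma>0$ if $h(y)\ge h(x)+\langle u,y-x\rangle+\frac{\gamma}{2}\|y-x\|^2$ for all $x,y$ and $u\in\partial h(x)$. For $\lambda>0$ and closed proper convex $h$, $\mathrm{Prox}_{\lambda h}(x)=\arg\min_y\{h(y)+\frac{1}{2\lambda}\|y-x\|^2\}$. Let $\phi=\frac{\sqrt5+1}{2}$. GRPDA with linesearch for the strongly convex case. Let $\psi_0=1.3247\ldots$ be the unique real root of $\psi^3-\psi-1=0$. Choose $\psi\in(\psi_0,\phi)$, $\beta>0$, $\tau_0>0$, $\mu\in(0,1)$, $x_0=z_0\in\mathbb{R}^q$, $y_0\in\mathbb{R}^p$; set $\varphi=\frac{1+\psi}{\psi^2}$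 (then $\psi>\varphi$). For $n=1,2,\ldots$: (1) $z_n=\frac{\psi-1}{\psi}x_{n-1}+\frac1\psi z_{n-1}$ and $x_n=\mathrm{Prox}_{\tau_{n-1}g}(z_n-\tau_{n-1}K^\top y_{n-1})$; (2) (linesearch) $y_n=\mathrm{Prox}_{\beta\tau_n f^*}(y_{n-1}+\beta\tau_n Kx_n)$, where $\tau_n=\varphi\tau_{n-1}\mu^i$ and $i$ is the smallest nonnegative integer such that, with this $\tau_n$ and the corresponding $y_n$, $\sqrt{\beta\tau_n}\,\|K^\top y_n-K^\top y_{n-1}\|\le\sqrt{\psi/\tau_{n-1}}\,\|y_n-y_{n-1}\|$. (Such an $i$ always exists.) *)

theory Defs
  imports "HOL-Analysis.Analysis"
begin

section \<open>Extended-real-valued convex functions\<close>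

definition eff_dom :: "('a \<Rightarrow> ereal) \<Rightarrow> 'a set" where
  "eff_dom h = {x. h x < \<infinity>}"

definition epi :: "('a \<Rightarrow> ereal) \<Rightarrow> ('a \<times> real) set" where
  "epi h = {(x, r). h x \<le> ereal r}"

definition closed_proper_convex :: "('a::euclidean_space \<Rightarrow> ereal) \<Rightarrow> bool" where
  "closed_proper_convex h \<longleftrightarrow>
     closed (epi h) \<and> convex (epi h) \<and> (\<forall>x. h x \<noteq> -\<infinity>) \<and> eff_dom h \<noteq> {}"

definition conjugate :: "('a::euclidean_space \<Rightarrow> ereal) \<Rightarrow> 'a \<Rightarrow> ereal" where
  "conjugate h y = (SUP x. ereal (y \<bullet> x) - h x)"

text \<open>For proper \<open>h\<close> this set is empty at every point outside the effective domain.\<close>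

definition subdiff :: "('a::euclidean_space \<Rightarrow> ereal) \<Rightarrow> 'a \<Rightarrow> 'a set" where
  "subdiff h x = {u. \<forall>y. h x + ereal (u \<bullet> (y - x)) \<le> h y}"

definition strongly_convex :: "real \<Rightarrow> ('a::euclidean_space \<Rightarrow> ereal) \<Rightarrow> bool" where
  "strongly_convex \<gamma> h \<longleftrightarrow>
     (\<forall>x y. \<forall>u \<in> subdiff h x.
        h x + ereal (u \<bullet> (y - x)) + ereal (\<gamma> / 2 * (norm (y - x))\<^sup>2) \<le> h y)"

text \<open>For closed proper convex \<open>h\<close> and \<open>c > 0\<close> the minimizer exists and is unique, so the
  choice made by \<^const>\<open>arg_min\<close> is immaterial.\<close>

definition prox :: "real \<Rightarrow> ('a::euclidean_space \<Rightarrow> ereal) \<Rightarrow> 'a \<Rightarrow> 'a" where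
  "prox c h x = arg_min (\<lambda>y. h y + ereal (1 / (2 * c) * (norm (y - x))\<^sup>2)) (\<lambda>_. True)"

section \<open>Primal, dual and saddle point problems\<close>

text \<open>\<open>K\<close> is a matrix with rows indexed by \<open>'p\<close> and columns by \<open>'q\<close>, acting from
  \<open>real^'q\<close> to \<open>real^'p\<close>.\<close>

definition primal_solutions ::
  "(real^'q \<Rightarrow> ereal) \<Rightarrow> (real^'p \<Rightarrow> ereal) \<Rightarrow> real^'q^'p \<Rightarrow> (real^'q) set" where
  "primal_solutions g f K = {x. is_arg_min (\<lambda>x. g x + f (K *v x)) (\<lambda>_. True) x}"

definition dual_solutions ::
  "(real^'q \<Rightarrow> ereal) \<Rightarrow> (real^'p \<Rightarrow> ereal) \<Rightarrow> real^'q^'p \<Rightarrow> (real^'p) set" where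
  "dual_solutions g f K =
     {y. is_arg_max (\<lambda>y. - conjugate f y - conjugate g (- (transpose K *v y))) (\<lambda>_. True) y}"

definition saddle_points ::
  "(real^'q \<Rightarrow> ereal) \<Rightarrow> (real^'p \<Rightarrow> ereal) \<Rightarrow> real^'q^'p \<Rightarrow> ((real^'q) \<times> (real^'p)) set" where
  "saddle_points g f K =
     {(x, y). 0 \<in> (\<lambda>u. u + transpose K *v y) ` subdiff g x \<and>
              0 \<in> (\<lambda>v. v - K *v x) ` subdiff (conjugate f) y}"

definition lagrangian ::
  "(real^'q \<Rightarrow> ereal) \<Rightarrow> (real^'p \<Rightarrow> ereal) \<Rightarrow> real^'q^'p \<Rightarrow> real^'q \<Rightarrow> real^'p \<Rightarrow> ereal" where
  "lagrangian g f K x y = g x + ereal ((K *v x) \<bullet> y) - conjugate f y"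

text \<open>With \<open>(xbar, ybar)\<close> a saddle point, \<open>g xbar\<close> and \<open>conjugate f ybar\<close> are finite, so no
  indeterminate form \<open>\<infinity> - \<infinity>\<close> occurs.\<close>

definition pd_gap ::
  "(real^'q \<Rightarrow> ereal) \<Rightarrow> (real^'p \<Rightarrow> ereal) \<Rightarrow> real^'q^'p \<Rightarrow> real^'q \<Rightarrow> real^'p \<Rightarrow>
   real^'q \<Rightarrow> real^'p \<Rightarrow> ereal" where
  "pd_gap g f K xbar ybar x y = lagrangian g f K x ybar - lagrangian g f K xbar y"

section \<open>GRPDA with linesearch, strongly convex case\<close>

definition psi0 :: real where
  "psi0 = (THE r. r ^ 3 - r - 1 = 0)"

definition golden_ratio :: real where
  "golden_ratio = (sqrt 5 + 1) / 2"

definition dual_step ::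
  "(real^'p \<Rightarrow> ereal) \<Rightarrow> real^'q^'p \<Rightarrow> real \<Rightarrow> real^'q \<Rightarrow> real^'p \<Rightarrow> real \<Rightarrow> real^'p" where
  "dual_step f K \<beta> x y t = prox (\<beta> * t) (conjugate f) (y + (\<beta> * t) *\<^sub>R (K *v x))"

text \<open>Acceptance of the trial step size \<open>t\<close>: here \<open>s\<close> and \<open>y\<close> are the previous step size and
  dual iterate, \<open>x\<close> is the new primal iterate.\<close>

definition ls_accept ::
  "(real^'p \<Rightarrow> ereal) \<Rightarrow> real^'q^'p \<Rightarrow> real \<Rightarrow> real \<Rightarrow> real \<Rightarrow> real^'q \<Rightarrow> real^'p \<Rightarrow> real \<Rightarrow> bool"
  where
  "ls_accept f K \<psi> \<beta> s x y t \<longleftrightarrow>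
     sqrt (\<beta> * t) * norm (transpose K *v dual_step f K \<beta> x y t - transpose K *v y)
       \<le> sqrt (\<psi> / s) * norm (dual_step f K \<beta> x y t - y)"

text \<open>A trial step size is always accepted after finitely many backtracking steps, so \<open>LEAST\<close>
  below is well defined.\<close>

definition grpda_linesearch ::
  "(real^'q \<Rightarrow> ereal) \<Rightarrow> (real^'p \<Rightarrow> ereal) \<Rightarrow> real^'q^'p \<Rightarrow> real \<Rightarrow> real \<Rightarrow> real \<Rightarrow>
   (nat \<Rightarrow> real^'q) \<Rightarrow> (nat \<Rightarrow> real^'q) \<Rightarrow> (nat \<Rightarrow> real^'p) \<Rightarrow> (nat \<Rightarrow> real) \<Rightarrow> bool" where
  "grpda_linesearch g f K \<psi> \<beta> \<mu> z x y \<tau> \<longleftrightarrow>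
     x 0 = z 0 \<and>
     (\<forall>n. let \<phi> = (1 + \<psi>) / \<psi>\<^sup>2 in
       z (Suc n) = ((\<psi> - 1) / \<psi>) *\<^sub>R x n + (1 / \<psi>) *\<^sub>R z n \<and>
       x (Suc n) = prox (\<tau> n) g (z (Suc n) - \<tau> n *\<^sub>R (transpose K *v y n)) \<and>
       \<tau> (Suc n) = \<phi> * \<tau> n *
         \<mu> ^ (LEAST i. ls_accept f K \<psi> \<beta> (\<tau> n) (x (Suc n)) (y n) (\<phi> * \<tau> n * \<mu> ^ i)) \<and>
       y (Suc n) = dual_step f K \<beta> (x (Suc n)) (y n) (\<tau> (Suc n)))"

end

theory Submission
  imports Defs
begin

text \<open>
  Since \<open>f\<^sup>*\<close> is strongly convex, \<open>f\<close> is finite everywhere and satisfies a quadratic upper bound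
  along every subgradient, so a primal minimizer \<open>x\<close> is completed to a saddle point by the dual
  point at which \<open>K x\<close> is a subgradient of \<open>f\<^sup>*\<close>; strong monotonicity makes the saddle point unique.

  For the iteration, the energy \<open>E n = \<psi>/(\<psi>-1) \<parallel>z (n+2) - xbar\<parallel>\<^sup>2 + \<parallel>y n - ybar\<parallel>\<^sup>2/\<beta>\<close> satisfies
  \<open>(1 + t\<gamma>) E (n+1) + 2 t G (n+1) \<le> (1 + t\<gamma>/\<psi>) E n\<close> with \<open>t = \<tau> (n+1)\<close> and
  \<open>\<gamma> = min \<gamma>\<^sub>g (\<beta>\<gamma>\<^sub>f)\<close>. This is a contraction by a fixed factor whenever \<open>t\<close> exceeds a threshold.
  The step sizes need not be bounded below, but \<open>\<tau> n\<close> either grows by the factor \<open>(1+\<psi>)/\<psi>\<^sup>2 > 1\<close> or has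
  \<open>\<tau> n \<tau> (n-1)\<close> bounded below, so asymptotically at least half of them exceed the threshold.
\<close>

section \<open>Closed proper convex functions\<close>

lemma norm_add_sq:
  fixes a b :: "'a::real_inner"
  shows "(norm (a + b))\<^sup>2 = (norm a)\<^sup>2 + 2 * (a \<bullet> b) + (norm b)\<^sup>2"
  by (simp add: power2_norm_eq_inner inner_add_left inner_add_right inner_commute)

text \<open>The quadratic lower bound confines a sublevel set of \<open>h + q\<close> to a bounded
  piece of the epigraph. There the continuous function \<open>r + q v\<close> attains its minimum,
  so closedness of \<open>epi h\<close> does the work of lower semicontinuity.\<close>

lemma attains_min:
  fixes h :: "'a::euclidean_space \<Rightarrow> ereal" and q :: "'a \<Rightarrow> real"
  assumes cl: "closed (epi h)" and q: "continuous_on UNIV q" and \<kappa>: "\<kappa> > 0"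
    and lower: "\<And>v. ereal (a + \<kappa> * (norm (v - p))\<^sup>2) \<le> h v + ereal (q v)"
    and v0: "h v0 < \<infinity>"
  obtains v where "\<And>w. h v + ereal (q v) \<le> h w + ereal (q w)"
proof -
  obtain r0 where r0: "h v0 = ereal r0"
    using v0 lower[of v0] by (cases "h v0") auto
  define M where "M = r0 + q v0"
  define S where "S = epi h \<inter> {(v, r). r + q v \<le> M}"
  have cq: "continuous_on A (\<lambda>w::'a \<times> real. snd w + q (fst w))" for A
    by (rule continuous_on_add[OF continuous_on_snd[OF continuous_on_id]
          continuous_on_compose2[OF q continuous_on_fst[OF continuous_on_id]]]) simp
  have "closed {w::'a \<times> real. snd w + q (fst w) \<le> M}"
    by (rule closed_Collect_le[OF cq continuous_on_const])
  then have "closed S"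
    unfolding S_def case_prod_beta using cl by (rule closed_Int[rotated])
  define R where "R = sqrt ((M - a) / \<kappa>)"
  have low: "a + \<kappa> * (norm (v - p))\<^sup>2 \<le> r + q v" if "(v, r) \<in> epi h" for v r
  proof -
    have "ereal (a + \<kappa> * (norm (v - p))\<^sup>2) \<le> ereal r + ereal (q v)"
      using order_trans[OF lower[of v] add_right_mono[of "h v" "ereal r"]] that
      by (auto simp: epi_def)
    then show ?thesis by simp
  qed
  have inball: "v \<in> cball p R" if "(v, r) \<in> S" for v r
  proof -
    have "\<kappa> * (norm (v - p))\<^sup>2 \<le> M - a"
      using low[of v r] that by (auto simp: S_def)
    then have "(norm (v - p))\<^sup>2 \<le> (M - a) / \<kappa>"
      using \<kappa> by (simp add: field_simps)
    then have "norm (v - p) \<le> R"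
      unfolding R_def by (rule real_le_rsqrt)
    then show ?thesis by (simp add: dist_norm norm_minus_commute)
  qed
  have "bounded (q ` cball p R)"
    by (rule compact_imp_bounded[OF compact_continuous_image[OF continuous_on_subset[OF q]]]) auto
  then obtain B where B: "\<bar>q v\<bar> \<le> B" if "v \<in> cball p R" for v
    unfolding bounded_iff by (metis image_eqI real_norm_def)
  have "S \<subseteq> cball p R \<times> {a - B .. M + B}"
  proof clarify
    fix v r assume vr: "(v, r) \<in> S"
    have v: "v \<in> cball p R" using inball vr .
    have "a \<le> a + \<kappa> * (norm (v - p))\<^sup>2" using \<kappa> by simp
    also have "\<dots> \<le> r + q v" using low vr by (auto simp: S_def)
    finally show "v \<in> cball p R \<and> r \<in> {a - B .. M + B}"
      using B[OF v] v vr by (auto simp: S_def)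
  qed
  then have "bounded S"
    by (rule bounded_subset[OF bounded_Times[OF bounded_cball bounded_closed_interval]])
  with \<open>closed S\<close> have "compact S" by (simp add: compact_eq_bounded_closed)
  moreover have "(v0, r0) \<in> S" by (auto simp: S_def epi_def r0 M_def)
  ultimately obtain w where w: "w \<in> S" "\<And>u. u \<in> S \<Longrightarrow> snd w + q (fst w) \<le> snd u + q (fst u)"
    using continuous_attains_inf[OF _ _ cq, of S] by (metis empty_iff)
  have key: "h (fst w) + ereal (q (fst w)) \<le> h v + ereal (q v)" for v
  proof (cases "h v")
    case (real r)
    have "h (fst w) + ereal (q (fst w)) \<le> ereal (snd w) + ereal (q (fst w))"
      using w(1) by (intro add_right_mono) (auto simp: S_def epi_def)
    also have "\<dots> \<le> ereal (r + q v)"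
    proof (cases "r + q v \<le> M")
      case True
      then have "(v, r) \<in> S" using real by (auto simp: S_def epi_def)
      then show ?thesis using w(2)[of "(v, r)"] by simp
    next
      case False
      then show ?thesis using w(1) by (auto simp: S_def)
    qed
    finally show ?thesis using real by simp
  next
    case MInf
    then show ?thesis using lower[of v] by simp
  qed simp
  then show thesis using that by blast
qed

text \<open>Fermat's rule: \<open>-u\<close> is a gradient of \<open>q\<close> at \<open>v\<close>, in a one-sided quadratic sense.\<close>

lemma min_subgradient:
  fixes h :: "'a::euclidean_space \<Rightarrow> ereal"
  assumes "convex (epi h)" and fin: "h v = ereal r"
    and proper: "\<And>y. h y \<noteq> -\<infinity>"
    and min: "\<And>y. h v + ereal (q v) \<le> h y + ereal (q y)"
    and q: "\<And>y t. 0 < t \<Longrightarrow> t \<le> 1 \<Longrightarrow> q (v + t *\<^sub>R (y - v)) \<le> q v - t * (u \<bullet> (y - v)) + t\<^sup>2 * C y"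
  shows "u \<in> subdiff h v"
  unfolding subdiff_def
proof clarify
  fix y
  show "h v + ereal (u \<bullet> (y - v)) \<le> h y"
  proof (cases "h y")
    case (real s)
    \<comment> \<open>Convexity on the segment from \<open>v\<close> to \<open>y\<close>, combined
      with minimality at \<open>v\<close>, leaves an inequality divisible by \<open>t\<close>;
      afterwards \<open>t\<close> tends to 0 from above.\<close>
    have *: "r + u \<bullet> (y - v) - s \<le> t * C y" if t: "0 < t" "t \<le> 1" for t
    proof -
      have "(1 - t) *\<^sub>R (v, r) + t *\<^sub>R (y, s) \<in> epi h"
        using assms(1) t fin real by (intro convexD) (auto simp: epi_def)
      moreover have "(1 - t) *\<^sub>R (v, r) + t *\<^sub>R (y, s) = (v + t *\<^sub>R (y - v), (1 - t) * r + t * s)"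
        by (simp add: algebra_simps)
      ultimately have "h (v + t *\<^sub>R (y - v)) \<le> ereal ((1 - t) * r + t * s)"
        by (simp add: epi_def)
      then have "ereal (r + q v) \<le> ereal ((1 - t) * r + t * s) + ereal (q (v + t *\<^sub>R (y - v)))"
        using min[of "v + t *\<^sub>R (y - v)"] fin
        by (smt (verit) add_right_mono order_trans plus_ereal.simps(1))
      then have "r + q v \<le> (1 - t) * r + t * s + q (v + t *\<^sub>R (y - v))" by simp
      with q[OF t, of y] have "t * (r + u \<bullet> (y - v) - s) \<le> t * (t * C y)"
        by (simp add: algebra_simps power2_eq_square)
      then show ?thesis using t by simp
    qed
    have "((\<lambda>t. t * C y) \<longlongrightarrow> 0 * C y) (at_right 0)"
      by (intro tendsto_intros)
    moreover have "eventually (\<lambda>t. r + u \<bullet> (y - v) - s \<le> t * C y) (at_right (0::real))"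
      using * by (auto simp: eventually_at_right_field intro!: exI[of _ 1])
    ultimately have "r + u \<bullet> (y - v) - s \<le> 0 * C y"
      by (intro tendsto_lowerbound) auto
    then show ?thesis using fin real by simp
  qed (use proper in auto)
qed

lemma cpc_finite:
  assumes "closed_proper_convex h"
  obtains x r where "h x = ereal r"
proof -
  from assms obtain x where "h x < \<infinity>" "h x \<noteq> -\<infinity>"
    by (auto simp: closed_proper_convex_def eff_dom_def)
  then show thesis using that by (cases "h x") auto
qed

text \<open>Strict separation of a point from the closed convex epigraph. \<open>\<alpha>\<close>
  cannot be negative because the epigraph is unbounded upwards; the vertical case
  \<open>\<alpha> = 0\<close> remains possible.\<close>

lemma cpc_separate_epi:
  fixes h :: "'a::euclidean_space \<Rightarrow> ereal"
  assumes h: "closed_proper_convex h" and x: "\<not> h x \<le> ereal R"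
  obtains a \<alpha> b where "\<alpha> \<ge> 0" "a \<bullet> x + \<alpha> * R < b"
    "\<And>y r. h y \<le> ereal r \<Longrightarrow> b < a \<bullet> y + \<alpha> * r"
proof -
  have "closed (epi h)" "convex (epi h)" using h by (auto simp: closed_proper_convex_def)
  moreover have "(x, R) \<notin> epi h" using x by (simp add: epi_def)
  ultimately obtain c b where c: "c \<bullet> (x, R) < b" "\<forall>w\<in>epi h. b < c \<bullet> w"
    using separating_hyperplane_closed_point by blast
  obtain a \<alpha> where [simp]: "c = (a, \<alpha>)" by (cases c)
  have sep: "b < a \<bullet> y + \<alpha> * r" if "h y \<le> ereal r" for y r
    using c(2) that by (auto simp: epi_def)
  obtain x0 r0 where x0: "h x0 = ereal r0" using cpc_finite[OF h] .
  have "\<alpha> \<ge> 0"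
  proof (rule ccontr)
    assume neg: "\<not> \<alpha> \<ge> 0"
    \<comment> \<open>A height at which a negative \<open>\<alpha>\<close> would put an epigraph
      point on the wrong side of the hyperplane.\<close>
    define r where "r = max r0 ((b - a \<bullet> x0) / \<alpha>)"
    have "b < a \<bullet> x0 + \<alpha> * r" by (intro sep) (simp add: x0 r_def)
    moreover have "\<alpha> * r \<le> \<alpha> * ((b - a \<bullet> x0) / \<alpha>)"
      using neg by (intro mult_left_mono_neg) (auto simp: r_def)
    ultimately show False using neg by simp
  qed
  then show thesis using c(1) by (intro that[OF _ _ sep]) auto
qed

section \<open>Conjugates and biconjugation\<close>

lemma conjugate_leI:
  assumes "\<And>y r. h y = ereal r \<Longrightarrow> u \<bullet> y - r \<le> c" and "\<And>y. h y \<noteq> -\<infinity>"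
  shows "conjugate h u \<le> ereal c"
  unfolding conjugate_def
proof (rule SUP_least)
  fix y show "ereal (u \<bullet> y) - h y \<le> ereal c"
    using assms by (cases "h y") auto
qed

lemma conjugate_upper:
  assumes "h y = ereal r"
  shows "ereal (u \<bullet> y - r) \<le> conjugate h u"
  unfolding conjugate_def by (rule SUP_upper2[of y]) (use assms in auto)

text \<open>A point just below the graph over the effective domain can only be cut off by a
  non-vertical hyperplane. That hyperplane is the graph of an affine minorant, and a bound on the
  conjugate at \<open>u\<close> is a minorant with slope \<open>u\<close> and intercept
  \<open>- c\<close>.\<close>

lemma cpc_conjugate_bound:
  fixes h :: "'a::euclidean_space \<Rightarrow> ereal"
  assumes h: "closed_proper_convex h"
  obtains u c where "conjugate h u \<le> ereal c"
proof -
  obtain x0 r0 where x0: "h x0 = ereal r0" using cpc_finite[OF h] .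
  then have "\<not> h x0 \<le> ereal (r0 - 1)" by simp
  from cpc_separate_epi[OF h this] obtain a \<alpha> b where s: "\<alpha> \<ge> 0" "a \<bullet> x0 + \<alpha> * (r0 - 1) < b"
    "\<And>y r. h y \<le> ereal r \<Longrightarrow> b < a \<bullet> y + \<alpha> * r"
    by (metis (no_types, lifting))
  have "b < a \<bullet> x0 + \<alpha> * r0" by (rule s) (simp add: x0)
  with s(2) have "\<alpha> > 0" by (simp add: right_diff_distrib)
  have "conjugate h ((- 1 / \<alpha>) *\<^sub>R a) \<le> ereal (- b / \<alpha>)"
  proof (rule conjugate_leI)
    fix y r assume "h y = ereal r"
    then have "b / \<alpha> < (a \<bullet> y + \<alpha> * r) / \<alpha>"
      using s(3)[of y r] \<open>\<alpha> > 0\<close> by (intro divide_strict_right_mono) auto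
    then show "((- 1 / \<alpha>) *\<^sub>R a) \<bullet> y - r \<le> - b / \<alpha>"
      using \<open>\<alpha> > 0\<close> by (simp add: add_divide_distrib)
  qed (use h in \<open>auto simp: closed_proper_convex_def\<close>)
  then show thesis using that by blast
qed

text \<open>The nontrivial half of the Fenchel-Moreau theorem: \<open>h\<close> lies below its
  biconjugate. A non-vertical separating hyperplane is an affine minorant exceeding \<open>R\<close>
  at \<open>x\<close>; a vertical one serves to tilt some given affine minorant until it exceeds
  \<open>R\<close> there.\<close>

lemma fenchel_moreau_le:
  fixes h :: "'a::euclidean_space \<Rightarrow> ereal"
  assumes h: "closed_proper_convex h"
    and R: "\<And>u c. conjugate h u = ereal c \<Longrightarrow> u \<bullet> x - c \<le> R"
  shows "h x \<le> ereal R"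
proof (rule ccontr)
  assume "\<not> h x \<le> ereal R"
  from cpc_separate_epi[OF h this] obtain a \<alpha> b where s: "\<alpha> \<ge> 0" "a \<bullet> x + \<alpha> * R < b"
    "\<And>y r. h y \<le> ereal r \<Longrightarrow> b < a \<bullet> y + \<alpha> * r"
    by (metis (no_types, lifting))
  obtain x0 r0 where x0: "h x0 = ereal r0" using cpc_finite[OF h] .
  have nM: "h y \<noteq> -\<infinity>" for y using h by (auto simp: closed_proper_convex_def)
  have R': "u \<bullet> x - c \<le> R" if "conjugate h u \<le> ereal c" for u c
    using R[of u] that conjugate_upper[of h, OF x0, of u] by (cases "conjugate h u") auto
  show False
  proof (cases "\<alpha> = 0")
    case False
    then have \<alpha>: "\<alpha> > 0" using s(1) by simp
    have "conjugate h ((- 1 / \<alpha>) *\<^sub>R a) \<le> ereal (- b / \<alpha>)"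
    proof (rule conjugate_leI)
      fix y r assume "h y = ereal r"
      then have "b / \<alpha> < (a \<bullet> y + \<alpha> * r) / \<alpha>"
        using s(3)[of y r] \<open>\<alpha> > 0\<close> by (intro divide_strict_right_mono) auto
      then show "((- 1 / \<alpha>) *\<^sub>R a) \<bullet> y - r \<le> - b / \<alpha>"
        using \<open>\<alpha> > 0\<close> by (simp add: add_divide_distrib)
    qed (rule nM)
    from R'[OF this] show False using s(2) \<alpha> by (simp add: field_simps)
  next
    case True
    \<comment> \<open>On the effective domain \<open>k * (b - a \<bullet> y)\<close> is negative, so
      adding it to the minorant given by \<open>u\<close> and \<open>c\<close> keeps a minorant. At
      \<open>x\<close> it adds \<open>k * d\<close>, and \<open>k\<close> is chosen large enough to
      pass \<open>R\<close>.\<close>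
    obtain u c where uc: "conjugate h u \<le> ereal c" using cpc_conjugate_bound[OF h] .
    define d where "d = b - a \<bullet> x"
    have d: "d > 0" using s(2) True by (simp add: d_def)
    define k where "k = (\<bar>R + c - u \<bullet> x\<bar> + 1) / d"
    have k: "k > 0" using d by (auto simp: k_def intro!: divide_pos_pos)
    have "conjugate h (u - k *\<^sub>R a) \<le> ereal (c - k * b)"
    proof (rule conjugate_leI)
      fix y r assume y: "h y = ereal r"
      have "u \<bullet> y - r \<le> c" using order_trans[OF conjugate_upper[of h, OF y, of u] uc] by simp
      moreover have "k * b \<le> k * (a \<bullet> y)" using s(3)[of y r] y k True by simp
      ultimately show "(u - k *\<^sub>R a) \<bullet> y - r \<le> c - k * b" by (simp add: inner_diff_left)
    qed (rule nM)
    from R'[OF this] have "k * d \<le> R + c - u \<bullet> x" by (simp add: d_def algebra_simps)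
    moreover have "k * d = \<bar>R + c - u \<bullet> x\<bar> + 1" using d by (simp add: k_def)
    ultimately show False by simp
  qed
qed

text \<open>The epigraph of the conjugate is an intersection of closed half-spaces, one for each
  point of \<open>epi h\<close>. Properness comes from one finite value of \<open>h\<close> and one
  affine minorant.\<close>

lemma cpc_conjugate:
  fixes h :: "'a::euclidean_space \<Rightarrow> ereal"
  assumes h: "closed_proper_convex h"
  shows "closed_proper_convex (conjugate h)"
proof -
  have nM: "h y \<noteq> -\<infinity>" for y using h by (auto simp: closed_proper_convex_def)
  obtain x0 r0 where x0: "h x0 = ereal r0" using cpc_finite[OF h] .
  have epi: "epi (conjugate h) = (\<Inter>w\<in>epi h. {v. (- fst w, 1) \<bullet> v \<ge> - snd w})"
  proof (intro set_eqI iffI)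
    fix v :: "'a \<times> real" assume "v \<in> epi (conjugate h)"
    then have v: "conjugate h (fst v) \<le> ereal (snd v)" by (auto simp: epi_def)
    have "- snd w \<le> (- fst w, 1) \<bullet> v" if w: "w \<in> epi h" for w
    proof -
      obtain r where r: "h (fst w) = ereal r" "r \<le> snd w"
        using w nM[of "fst w"] by (cases "h (fst w)") (auto simp: epi_def)
      have "ereal (fst v \<bullet> fst w - r) \<le> ereal (snd v)"
        using conjugate_upper[of h, OF r(1)] v order_trans by blast
      then show ?thesis using r(2) by (cases v) (simp add: inner_commute)
    qed
    then show "v \<in> (\<Inter>w\<in>epi h. {v. (- fst w, 1) \<bullet> v \<ge> - snd w})" by auto
  next
    fix v :: "'a \<times> real" assume v: "v \<in> (\<Inter>w\<in>epi h. {v. (- fst w, 1) \<bullet> v \<ge> - snd w})"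
    have "conjugate h (fst v) \<le> ereal (snd v)"
    proof (rule conjugate_leI)
      fix y r assume "h y = ereal r"
      then have "(y, r) \<in> epi h" by (simp add: epi_def)
      with v have "- r \<le> (- y, 1) \<bullet> v" by force
      then show "fst v \<bullet> y - r \<le> snd v" by (cases v) (simp add: inner_commute)
    qed (rule nM)
    then show "v \<in> epi (conjugate h)" by (auto simp: epi_def split: prod.splits)
  qed
  have "closed (epi (conjugate h))" "convex (epi (conjugate h))"
    unfolding epi by (intro closed_INT convex_INT ballI closed_halfspace_ge convex_halfspace_ge)+
  moreover have "conjugate h y \<noteq> -\<infinity>" for y
    using conjugate_upper[of h, OF x0, of y] by auto
  moreover obtain u c where "conjugate h u \<le> ereal c" using cpc_conjugate_bound[OF h] .
  then have "u \<in> eff_dom (conjugate h)" by (auto simp: eff_dom_def intro: le_less_trans)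
  ultimately show ?thesis by (auto simp: closed_proper_convex_def)
qed

text \<open>The linear part of an affine minorant of \<open>h\<close> is absorbed by half of the
  quadratic term, so the objective is coercive and has a minimizer. Fermat's rule then yields the
  inclusion.\<close>

lemma prox_optimality:
  fixes h :: "'a::euclidean_space \<Rightarrow> ereal"
  assumes h: "closed_proper_convex h" and c: "c > 0"
  obtains r where "h (prox c h w) = ereal r"
    and "(1 / c) *\<^sub>R (w - prox c h w) \<in> subdiff h (prox c h w)"
proof -
  define q where "q = (\<lambda>v. 1 / (2 * c) * (norm (v - w))\<^sup>2)"
  have nM: "h y \<noteq> -\<infinity>" for y using h by (auto simp: closed_proper_convex_def)
  obtain x0 r0 where x0: "h x0 = ereal r0" using cpc_finite[OF h] .
  obtain u b where ub: "conjugate h u \<le> ereal b" using cpc_conjugate_bound[OF h] .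
  have minorant: "ereal (u \<bullet> v - b) \<le> h v" for v
  proof (cases "h v")
    case (real r)
    then show ?thesis using order_trans[OF conjugate_upper[of h, OF real, of u] ub] by simp
  qed (use nM in auto)
  have lower: "ereal (u \<bullet> w - b - c * (norm u)\<^sup>2 + 1 / (4 * c) * (norm (v - w))\<^sup>2) \<le> h v + ereal (q v)" for v
  proof -
    have "0 \<le> (1 / (4 * c)) * (norm ((v - w) + (2 * c) *\<^sub>R u))\<^sup>2" using c by simp
    also have "\<dots> = 1 / (4 * c) * (norm (v - w))\<^sup>2 + u \<bullet> (v - w) + c * (norm u)\<^sup>2"
      using c unfolding norm_add_sq
      by (simp add: field_simps inner_commute[of u] power2_eq_square[of c])
    finally have "u \<bullet> w - b - c * (norm u)\<^sup>2 + 1 / (4 * c) * (norm (v - w))\<^sup>2 \<le> (u \<bullet> v - b) + q v"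
      by (simp add: q_def inner_diff_right)
    then have "ereal (u \<bullet> w - b - c * (norm u)\<^sup>2 + 1 / (4 * c) * (norm (v - w))\<^sup>2)
        \<le> ereal (u \<bullet> v - b) + ereal (q v)" by simp
    also have "\<dots> \<le> h v + ereal (q v)" using minorant by (rule add_right_mono)
    finally show ?thesis .
  qed
  have "closed (epi h)" using h by (simp add: closed_proper_convex_def)
  moreover have "continuous_on UNIV q" unfolding q_def by (intro continuous_intros)
  moreover have "1 / (4 * c) > 0" using c by simp
  moreover have "h x0 < \<infinity>" using x0 by simp
  ultimately obtain v where "\<And>y. h v + ereal (q v) \<le> h y + ereal (q y)"
    using attains_min lower by blast
  then have "is_arg_min (\<lambda>y. h y + ereal (q y)) (\<lambda>_. True) v"
    by (simp add: is_arg_min_linorder)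
  \<comment> \<open>Once a minimizer exists, the choice operator inside \<open>arg_min\<close>
    returns one.\<close>
  then have "is_arg_min (\<lambda>y. h y + ereal (q y)) (\<lambda>_. True) (prox c h w)"
    unfolding prox_def q_def arg_min_def by (rule someI)
  then have min: "h (prox c h w) + ereal (q (prox c h w)) \<le> h y + ereal (q y)" for y
    by (simp add: is_arg_min_linorder)
  obtain r where r: "h (prox c h w) = ereal r"
    using min[of x0] x0 nM[of "prox c h w"] by (cases "h (prox c h w)") auto
  have "(1 / c) *\<^sub>R (w - prox c h w) \<in> subdiff h (prox c h w)"
  proof (rule min_subgradient[of h, OF _ r nM, where q = q])
    show "convex (epi h)" using h by (simp add: closed_proper_convex_def)
    show "h (prox c h w) + ereal (q (prox c h w)) \<le> h y + ereal (q y)" for y by (rule min)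
    fix y and t :: real
    let ?v = "prox c h w"
    have "q (?v + t *\<^sub>R (y - ?v)) = 1 / (2 * c) * (norm ((?v - w) + t *\<^sub>R (y - ?v)))\<^sup>2"
      by (simp add: q_def algebra_simps)
    also have "(norm ((?v - w) + t *\<^sub>R (y - ?v)))\<^sup>2
      = (norm (?v - w))\<^sup>2 - 2 * t * ((w - ?v) \<bullet> (y - ?v)) + t\<^sup>2 * (norm (y - ?v))\<^sup>2"
      using inner_minus_left[of "w - ?v"] by (simp add: norm_add_sq power_mult_distrib)
    finally have "q (?v + t *\<^sub>R (y - ?v)) = q ?v - t * (1 / c * ((w - ?v) \<bullet> (y - ?v)))
        + t\<^sup>2 * (1 / (2 * c) * (norm (y - ?v))\<^sup>2)"
      unfolding q_def using c by (simp add: right_diff_distrib distrib_left)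
    then show "q (?v + t *\<^sub>R (y - ?v)) \<le> q ?v - t * (((1 / c) *\<^sub>R (w - ?v)) \<bullet> (y - ?v))
        + t\<^sup>2 * (1 / (2 * c) * (norm (y - ?v))\<^sup>2)"
      by (simp only: inner_scaleR_left)
  qed
  with r show thesis using that by blast
qed

section \<open>Subgradients of strongly convex functions\<close>

lemma subdiff_finite:
  assumes "closed_proper_convex h" and "u \<in> subdiff h x"
  obtains r where "h x = ereal r"
proof -
  obtain x0 r0 where "h x0 = ereal r0" using cpc_finite[OF assms(1)] .
  moreover have "h x + ereal (u \<bullet> (x0 - x)) \<le> h x0"
    using assms(2) by (simp add: subdiff_def)
  moreover have "h x \<noteq> -\<infinity>" using assms(1) by (simp add: closed_proper_convex_def)
  ultimately show thesis using that by (cases "h x") auto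
qed

lemma subdiff_real:
  assumes "closed_proper_convex h" and "u \<in> subdiff h x"
  shows "h x = ereal (real_of_ereal (h x))"
  by (rule subdiff_finite[OF assms]) simp

lemma strongly_convex_real:
  assumes "strongly_convex \<gamma> h" and "u \<in> subdiff h x" and "h x = ereal r" and "h y = ereal s"
  shows "r + u \<bullet> (y - x) + \<gamma> / 2 * (norm (y - x))\<^sup>2 \<le> s"
proof -
  have "h x + ereal (u \<bullet> (y - x)) + ereal (\<gamma> / 2 * (norm (y - x))\<^sup>2) \<le> h y"
    using assms(1,2) by (simp add: strongly_convex_def)
  then show ?thesis using assms(3,4) by simp
qed

lemma strongly_monotone_subdiff:
  assumes h: "closed_proper_convex h" "strongly_convex \<gamma> h"
    and u: "u \<in> subdiff h x" and v: "v \<in> subdiff h y"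
  shows "\<gamma> * (norm (x - y))\<^sup>2 \<le> (u - v) \<bullet> (x - y)"
proof -
  obtain r where r: "h x = ereal r" using subdiff_finite[OF h(1) u] .
  obtain s where s: "h y = ereal s" using subdiff_finite[OF h(1) v] .
  show ?thesis
    using strongly_convex_real[OF h(2) u r s] strongly_convex_real[OF h(2) v s r]
    unfolding norm_minus_commute[of y x] by (simp add: inner_diff_left inner_diff_right)
qed

text \<open>Strong convexity at one point with a subgradient makes
  \<open>h v - w \<bullet> v\<close> coercive, and Fermat's rule at its minimizer produces
  \<open>w\<close>.\<close>

lemma subdiff_surj:
  fixes h :: "'a::euclidean_space \<Rightarrow> ereal"
  assumes h: "closed_proper_convex h" and sc: "strongly_convex \<gamma> h" and \<gamma>: "\<gamma> > 0"
  obtains y where "w \<in> subdiff h y"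
proof -
  \<comment> \<open>A prox point has a nonempty subdifferential, and \<open>strongly_convex\<close>
    gives information only at such points.\<close>
  define p where "p = prox 1 h 0"
  define u where "u = (1 / 1) *\<^sub>R (0 - p)"
  obtain r where r: "h p = ereal r" and u: "u \<in> subdiff h p"
    unfolding p_def u_def using prox_optimality[OF h zero_less_one, of 0] .
  have nM: "h y \<noteq> -\<infinity>" for y using h by (auto simp: closed_proper_convex_def)
  have lower: "ereal (r - w \<bullet> p - (norm (u - w))\<^sup>2 / \<gamma> + \<gamma> / 4 * (norm (v - p))\<^sup>2) \<le> h v + ereal (- (w \<bullet> v))"
    for v
  proof (cases "h v")
    case (real s)
    \<comment> \<open>Completing the square spends half of the \<open>\<gamma> / 2\<close> growth on
      the linear term.\<close>
    have "0 \<le> (norm ((1 / 2 * sqrt \<gamma>) *\<^sub>R (v - p) + (1 / sqrt \<gamma>) *\<^sub>R (u - w)))\<^sup>2" by simp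
    also have "\<dots> = \<gamma> / 4 * (norm (v - p))\<^sup>2 + (u - w) \<bullet> (v - p) + (norm (u - w))\<^sup>2 / \<gamma>"
      unfolding norm_add_sq using \<gamma>
      by (simp add: power_mult_distrib power_divide inner_commute del: scaleR_diff_right)
    finally show ?thesis
      using strongly_convex_real[OF sc u r real] unfolding real
      by (simp add: inner_diff_left inner_diff_right)
  qed (use nM in auto)
  have "closed (epi h)" using h by (simp add: closed_proper_convex_def)
  moreover have "continuous_on UNIV (\<lambda>v. - (w \<bullet> v))" by (intro continuous_intros)
  moreover have "\<gamma> / 4 > 0" using \<gamma> by simp
  moreover have "h p < \<infinity>" using r by simp
  ultimately obtain y where min: "\<And>v. h y + ereal (- (w \<bullet> y)) \<le> h v + ereal (- (w \<bullet> v))"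
    using attains_min[OF _ _ _ lower] by metis
  obtain s where s: "h y = ereal s"
    using min[of p] r nM[of y] by (cases "h y") auto
  have "w \<in> subdiff h y"
  proof (rule min_subgradient[of h, OF _ s nM, where q = "\<lambda>v. - (w \<bullet> v)"])
    show "convex (epi h)" using h by (simp add: closed_proper_convex_def)
    show "h y + ereal (- (w \<bullet> y)) \<le> h v + ereal (- (w \<bullet> v))" for v by (rule min)
    show "- (w \<bullet> (y + t *\<^sub>R (v - y))) \<le> - (w \<bullet> y) - t * (w \<bullet> (v - y)) + t\<^sup>2 * 0" for v and t :: real
      by (simp add: inner_add_right)
  qed
  then show thesis using that by blast
qed

text \<open>Duality between strong convexity and smoothness. By biconjugation it suffices to bound
  every affine minorant of \<open>f\<close> at \<open>w + d\<close>; strong convexity at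
  \<open>y\<close> turns this bound into a concave quadratic in the slope \<open>v\<close>,
  maximized by completing the square. The constant \<open>w \<bullet> y - c\<close> is the value of
  \<open>f\<close> at \<open>w\<close>.\<close>

lemma conjugate_strongly_convex_smooth:
  fixes f :: "'a::euclidean_space \<Rightarrow> ereal"
  assumes f: "closed_proper_convex f" and sc: "strongly_convex \<gamma> (conjugate f)" and \<gamma>: "\<gamma> > 0"
    and w: "w \<in> subdiff (conjugate f) y" and c: "conjugate f y = ereal c"
  shows "f (w + d) \<le> ereal (w \<bullet> y - c + y \<bullet> d + (norm d)\<^sup>2 / (2 * \<gamma>))"
proof (rule fenchel_moreau_le[OF f])
  fix v s assume s: "conjugate f v = ereal s"
  have "0 \<le> (norm (sqrt (\<gamma> / 2) *\<^sub>R (v - y) + (- 1 / sqrt (2 * \<gamma>)) *\<^sub>R d))\<^sup>2" by simp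
  also have "\<dots> = \<gamma> / 2 * (norm (v - y))\<^sup>2 - (v - y) \<bullet> d + (norm d)\<^sup>2 / (2 * \<gamma>)"
    unfolding norm_add_sq using \<gamma>
    by (simp add: power_mult_distrib power_divide real_sqrt_divide real_sqrt_mult
        del: scaleR_diff_right)
  finally show "v \<bullet> (w + d) - s \<le> w \<bullet> y - c + y \<bullet> d + (norm d)\<^sup>2 / (2 * \<gamma>)"
    using strongly_convex_real[OF sc w c s]
    by (simp add: inner_diff_left inner_diff_right inner_add_right inner_commute)
qed

section \<open>Saddle points\<close>

text \<open>The adjoint identity. Where it serves as a rewrite rule,
  \<open>transpose_matrix_vector\<close> is removed from the simpset so that terms keep the form
  \<open>transpose K *v y\<close>.\<close>

lemma transpose_inner:
  fixes K :: "real^'q^'p"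
  shows "(transpose K *v y) \<bullet> x = y \<bullet> (K *v x)"
  by (simp add: dot_lmul_matrix)

lemma saddle_points_iff:
  fixes K :: "real^'a^'b"
  shows "(x, y) \<in> saddle_points g f K \<longleftrightarrow>
     - (transpose K *v y) \<in> subdiff g x \<and> K *v x \<in> subdiff (conjugate f) y"
proof -
  have "0 \<in> (\<lambda>u. u + a) ` S \<longleftrightarrow> - a \<in> S" for a and S :: "(real^'a) set"
    by (auto simp: image_iff eq_commute[of 0] eq_neg_iff_add_eq_0[symmetric])
  moreover have "0 \<in> (\<lambda>v. v - a) ` S \<longleftrightarrow> a \<in> S" for a and S :: "(real^'b) set"
    by (auto simp: image_iff)
  ultimately show ?thesis unfolding saddle_points_def by simp
qed

text \<open>The quadratic upper bound on \<open>f\<close> lets \<open>f\<close> composed with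
  \<open>K\<close> act as the smooth part in Fermat's rule at the minimizer \<open>x\<close>. Its
  gradient there is given by the \<open>y\<close> for which \<open>K *v x\<close> is a subgradient
  of \<open>conjugate f\<close>.\<close>

lemma primal_solution_saddle_point:
  assumes g: "closed_proper_convex g" and f: "closed_proper_convex f"
    and sc: "strongly_convex \<gamma> (conjugate f)" and \<gamma>: "\<gamma> > 0"
    and x: "x \<in> primal_solutions g f K"
  obtains y where "(x, y) \<in> saddle_points g f K"
proof -
  have nM: "g v \<noteq> -\<infinity>" "f w \<noteq> -\<infinity>" for v w using g f by (auto simp: closed_proper_convex_def)
  have f': "closed_proper_convex (conjugate f)" by (rule cpc_conjugate[OF f])
  obtain y where y: "K *v x \<in> subdiff (conjugate f) y"
    using subdiff_surj[OF f' sc \<gamma>] .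
  obtain c where c: "conjugate f y = ereal c" using subdiff_finite[OF f' y] .
  note smooth = conjugate_strongly_convex_smooth[OF f sc \<gamma> y c]
  define F where "F v = real_of_ereal (f v)" for v
  have F: "f v = ereal (F v)" for v
    unfolding F_def using smooth[of "v - K *v x"] nM(2)[of v] by (cases "f v") auto
  \<comment> \<open>Fenchel-Young: this anchors the smooth bound at the actual value of
    \<open>f\<close> at \<open>K *v x\<close>.\<close>
  have Fx: "(K *v x) \<bullet> y - c \<le> F (K *v x)"
    using conjugate_upper[of f, OF F, of y "K *v x"] c by (simp add: inner_commute)
  have min: "g x + ereal (F (K *v x)) \<le> g v + ereal (F (K *v v))" for v
    using x by (simp add: primal_solutions_def is_arg_min_linorder F)
  obtain x0 r0 where "g x0 = ereal r0" using cpc_finite[OF g] .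
  with min[of x0] nM(1)[of x] obtain r where r: "g x = ereal r" by (cases "g x") auto
  have "- (transpose K *v y) \<in> subdiff g x"
  proof (rule min_subgradient[of g, OF _ r nM(1), where q = "\<lambda>v. F (K *v v)"])
    show "convex (epi g)" using g by (simp add: closed_proper_convex_def)
    show "g x + ereal (F (K *v x)) \<le> g v + ereal (F (K *v v))" for v by (rule min)
    fix v and t :: real
    let ?d = "K *v (v - x)"
    have "K *v (x + t *\<^sub>R (v - x)) = K *v x + t *\<^sub>R ?d"
      by (simp add: matrix_vector_right_distrib matrix_vector_mult_scaleR)
    with smooth[of "t *\<^sub>R ?d"] Fx
    have "F (K *v (x + t *\<^sub>R (v - x))) \<le> F (K *v x) + t * (y \<bullet> ?d) + (norm (t *\<^sub>R ?d))\<^sup>2 / (2 * \<gamma>)"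
      by (simp add: F)
    then show "F (K *v (x + t *\<^sub>R (v - x)))
        \<le> F (K *v x) - t * (- (transpose K *v y) \<bullet> (v - x)) + t\<^sup>2 * ((norm ?d)\<^sup>2 / (2 * \<gamma>))"
      by (simp add: inner_minus_left transpose_inner power_mult_distrib del: transpose_matrix_vector)
  qed
  with y show thesis using that by (simp add: saddle_points_iff)
qed

text \<open>Both inclusions are strongly monotone, and the coupling terms through \<open>K\<close>
  cancel on addition.\<close>

lemma saddle_point_unique:
  assumes g: "closed_proper_convex g" and f: "closed_proper_convex f"
    and scg: "strongly_convex \<gamma> g" "\<gamma> > 0" and scf: "strongly_convex \<delta> (conjugate f)" "\<delta> > 0"
    and 1: "(x, y) \<in> saddle_points g f K" and 2: "(x', y') \<in> saddle_points g f K"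
  shows "x = x' \<and> y = y'"
proof -
  have "\<gamma> * (norm (x - x'))\<^sup>2 \<le> (- (transpose K *v y) - - (transpose K *v y')) \<bullet> (x - x')"
    using 1 2 by (intro strongly_monotone_subdiff[OF g scg(1)]) (auto simp: saddle_points_iff)
  moreover have "\<delta> * (norm (y - y'))\<^sup>2 \<le> (K *v x - K *v x') \<bullet> (y - y')"
    using 1 2 by (intro strongly_monotone_subdiff[OF cpc_conjugate[OF f] scf(1)])
      (auto simp: saddle_points_iff)
  moreover have "(- (transpose K *v y) - - (transpose K *v y')) \<bullet> (x - x')
      = - ((K *v x - K *v x') \<bullet> (y - y'))"
    by (simp add: inner_diff_left inner_diff_right transpose_inner
        inner_commute[of "K *v x"] inner_commute[of "K *v x'"] del: transpose_matrix_vector)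
  ultimately have "\<gamma> * (norm (x - x'))\<^sup>2 + \<delta> * (norm (y - y'))\<^sup>2 \<le> 0" by linarith
  then show ?thesis
    using scg(2) scf(2)
    by (smt (verit) mult_pos_pos mult_nonneg_nonneg zero_le_power2 zero_less_power2
        norm_eq_zero right_minus_eq)
qed

text \<open>Fenchel-Young at \<open>x\<close> bounds \<open>conjugate g\<close> from below, with
  equality at \<open>y\<close>. Strong convexity of \<open>conjugate f\<close> then makes the dual
  objective drop quadratically away from \<open>y\<close>, which gives optimality and uniqueness at
  once.\<close>

lemma saddle_point_dual:
  assumes g: "closed_proper_convex g" and f: "closed_proper_convex f"
    and sc: "strongly_convex \<gamma> (conjugate f)" and \<gamma>: "\<gamma> > 0"
    and saddle: "(x, y) \<in> saddle_points g f K"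
  shows "dual_solutions g f K = {y}"
proof -
  define D where "D v = - conjugate f v - conjugate g (- (transpose K *v v))" for v
  have gx: "- (transpose K *v y) \<in> subdiff g x" and fy: "K *v x \<in> subdiff (conjugate f) y"
    using saddle by (auto simp: saddle_points_iff)
  have f': "closed_proper_convex (conjugate f)" and g': "closed_proper_convex (conjugate g)"
    using f g by (auto intro: cpc_conjugate)
  have nM: "conjugate f v \<noteq> -\<infinity>" "conjugate g u \<noteq> -\<infinity>" "g w \<noteq> -\<infinity>" for v u w
    using f' g' g by (auto simp: closed_proper_convex_def)
  obtain r where r: "g x = ereal r" using subdiff_finite[OF g gx] .
  obtain c where c: "conjugate f y = ereal c" using subdiff_finite[OF f' fy] .
  define d where "d = - (y \<bullet> (K *v x)) - r"
  have up: "ereal (- (v \<bullet> (K *v x)) - r) \<le> conjugate g (- (transpose K *v v))" for v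
    using conjugate_upper[of g, OF r, of "- (transpose K *v v)"]
    by (simp add: transpose_inner inner_minus_left del: transpose_matrix_vector)
  have "conjugate g (- (transpose K *v y)) \<le> ereal d"
  proof (rule conjugate_leI)
    fix v s assume s: "g v = ereal s"
    have "g x + ereal (- (transpose K *v y) \<bullet> (v - x)) \<le> g v"
      using gx by (simp add: subdiff_def)
    then show "- (transpose K *v y) \<bullet> v - s \<le> d"
      by (simp add: r s d_def transpose_inner inner_diff_right del: transpose_matrix_vector)
  qed (rule nM)
  with up[of y] have "conjugate g (- (transpose K *v y)) = ereal d"
    by (simp add: d_def)
  then have Dy: "D y = ereal (- c - d)" by (simp add: D_def c)
  have Dle: "D v \<le> ereal (- c - d - \<gamma> / 2 * (norm (v - y))\<^sup>2)" for v
  proof (cases "conjugate f v")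
    case s: (real s)
    show ?thesis
    proof (cases "conjugate g (- (transpose K *v v))")
      case (real e)
      then show ?thesis
        using strongly_convex_real[OF sc fy c s] up[of v]
        by (simp add: D_def s d_def inner_diff_right inner_commute)
    qed (use nM in \<open>auto simp: D_def s\<close>)
  next
    case PInf
    then show ?thesis
      using nM(2)[of "- (transpose K *v v)"]
      by (cases "conjugate g (- (transpose K *v v))") (auto simp: D_def)
  qed (use nM in auto)
  have "is_arg_max D (\<lambda>_. True) v \<longleftrightarrow> v = y" for v
  proof
    assume "is_arg_max D (\<lambda>_. True) v"
    then have "D y \<le> D v" by (simp add: is_arg_max_linorder)
    then have "ereal (- c - d) \<le> ereal (- c - d - \<gamma> / 2 * (norm (v - y))\<^sup>2)"
      unfolding Dy using Dle[of v] by (rule order_trans)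
    then have "\<gamma> * (norm (v - y))\<^sup>2 \<le> 0" by simp
    then show "v = y" using \<gamma> by (simp add: mult_le_0_iff)
  next
    assume "v = y"
    moreover have "D w \<le> D y" for w
      using order_trans[OF Dle[of w], of "ereal (- c - d)"] \<gamma> by (simp add: Dy)
    ultimately show "is_arg_max D (\<lambda>_. True) v" by (simp add: is_arg_max_linorder)
  qed
  then show ?thesis unfolding dual_solutions_def D_def by auto
qed

section \<open>The energy inequality\<close>

text \<open>The description operator in \<open>psi0\<close> has to be resolved by uniqueness of the
  root. The form \<open>r * (r\<^sup>2 - 1) = 1\<close> excludes roots up to 1; for two roots beyond
  1 the cofactor of their difference is positive.\<close>

lemma psi0_gt_1: "psi0 > 1"
proof -
  have gt: "r > 1" if "r ^ 3 - r - 1 = 0" for r :: real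
  proof (rule ccontr)
    assume "\<not> r > 1"
    have r: "r * (r\<^sup>2 - 1) = 1" using that by (simp add: power2_eq_square power3_eq_cube algebra_simps)
    consider "r \<le> -1" | "-1 \<le> r" "r \<le> 0" | "0 \<le> r" "r \<le> 1"
      using \<open>\<not> r > 1\<close> by linarith
    then show False
    proof cases
      case 1
      then have "r\<^sup>2 \<ge> 1" using abs_le_square_iff[of 1 r] by simp
      then have "r * (r\<^sup>2 - 1) \<le> 0" using 1 by (intro mult_nonpos_nonneg) auto
      with r show False by simp
    next
      case 2
      have "r * (r\<^sup>2 - 1) = r ^ 3 + (- r)" by (simp add: power2_eq_square power3_eq_cube algebra_simps)
      moreover have "r ^ 3 \<le> 0" using 2 by (simp add: power_le_zero_eq_numeral)
      ultimately have "r = -1" using r 2 by linarith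
      with r show False by simp
    next
      case 3
      then have "r\<^sup>2 \<le> 1" by (simp add: power_le_one)
      then have "r * (r\<^sup>2 - 1) \<le> 0" using 3 by (intro mult_nonneg_nonpos) auto
      with r show False by simp
    qed
  qed
  have "\<exists>r\<ge>1. r \<le> 2 \<and> r ^ 3 - r - 1 = (0::real)"
    by (intro IVT') (auto intro!: continuous_intros)
  then obtain r0 :: real where r0: "r0 ^ 3 - r0 - 1 = 0" by blast
  have uniq: "s = r0" if s: "s ^ 3 - s - 1 = 0" for s
  proof -
    have "(s - r0) * (s\<^sup>2 + s * r0 + r0\<^sup>2 - 1) = 0"
      using s r0 by (simp add: power2_eq_square power3_eq_cube algebra_simps)
    moreover have "s\<^sup>2 > 1" "s * r0 > 0" "r0\<^sup>2 > 0"
      using gt[OF s] gt[OF r0] by (auto intro: mult_pos_pos simp: one_less_power)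
    ultimately show ?thesis by auto
  qed
  have "psi0 = r0" unfolding psi0_def using r0 uniq by (rule the_equality)
  with gt[OF r0] show ?thesis by simp
qed

text \<open>The golden ratio is the positive root of \<open>\<psi>\<^sup>2 = 1 + \<psi>\<close>.
  This inequality makes the growth factor \<open>(1 + \<psi>) / \<psi>\<^sup>2\<close> of the step
  sizes exceed 1.\<close>

lemma below_golden_ratio:
  assumes "0 < \<psi>" and "\<psi> < golden_ratio"
  shows "\<psi>\<^sup>2 < 1 + \<psi>"
proof -
  define s where "s = sqrt (5::real)"
  have s: "s \<ge> 1" "s\<^sup>2 = 5" "\<psi> < (s + 1) / 2"
    using assms(2) by (simp_all add: s_def golden_ratio_def)
  then have "2 * \<psi> - 1 < s" "- (2 * \<psi> - 1) < s" using assms(1) by simp_all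
  then have "\<not> s\<^sup>2 \<le> (2 * \<psi> - 1)\<^sup>2"
    unfolding abs_le_square_iff[symmetric] by (simp add: abs_if)
  then have "(2 * \<psi> - 1)\<^sup>2 < 5" using s(2) by simp
  then show ?thesis by (simp add: power2_eq_square algebra_simps)
qed

lemma double_inner:
  fixes a b c :: "'a::real_inner"
  shows "2 * ((a - b) \<bullet> (c - a)) = (norm (b - c))\<^sup>2 - (norm (a - b))\<^sup>2 - (norm (a - c))\<^sup>2"
  by (simp add: power2_norm_eq_inner inner_diff_left inner_diff_right inner_commute)

text \<open>The identity for the squared norm of a convex combination, solved for one endpoint. It
  trades the distance of a primal iterate to the solution for distances of two consecutive
  \<open>z\<close>.\<close>

lemma norm_convex_comb_sq:
  fixes a b c :: "'a::real_inner"
  assumes "\<psi> > 1"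
  shows "(norm (a - c))\<^sup>2
    = \<psi> / (\<psi> - 1) * (norm (((\<psi> - 1) / \<psi>) *\<^sub>R a + (1 / \<psi>) *\<^sub>R b - c))\<^sup>2
      - 1 / (\<psi> - 1) * (norm (b - c))\<^sup>2 + 1 / \<psi> * (norm (b - a))\<^sup>2"
proof -
  define p where "p = 1 / \<psi>"
  define u v where "u = a - c" and "v = b - c"
  have p: "(\<psi> - 1) / \<psi> = 1 - p" "\<psi> / (\<psi> - 1) = 1 / (1 - p)" "1 / (\<psi> - 1) = p / (1 - p)" "p < 1" "p \<noteq> 1"
    using assms by (auto simp: p_def field_simps)
  have 1: "(1 - p) *\<^sub>R a + p *\<^sub>R b - c = (1 - p) *\<^sub>R u + p *\<^sub>R v" "b - a = v + - u"
    by (auto simp: u_def v_def algebra_simps)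
  show ?thesis
    unfolding p_def[symmetric] p(1-3) 1 u_def[symmetric] v_def[symmetric] norm_add_sq
    using p(4,5) by (simp add: power_mult_distrib divide_simps inner_commute[of v u])
      (simp add: power2_eq_square algebra_simps)
qed

text \<open>\<open>x\<close>, \<open>x'\<close> are consecutive primal iterates, \<open>w0\<close>,
  \<open>w\<close>, \<open>w'\<close> consecutive \<open>z\<close>, and \<open>s\<close>,
  \<open>t\<close> consecutive step sizes. \<open>A\<close> tests the prox inclusion of
  \<open>x'\<close> at the solution, \<open>B\<close> that of \<open>x\<close> at \<open>x'\<close>,
  and \<open>C\<close> the dual one at the solution. Their sum, scaled by \<open>t\<close>, leaves
  one cross term, which the linesearch test \<open>LS\<close> absorbs.\<close>

lemma grpda_energy_step:
  fixes K :: "real^'q^'p" and x x' w0 w w' xb :: "real^'q" and y y' yb :: "real^'p"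
  assumes pos: "\<psi> > 1" "s > 0" "t > 0" "\<beta> > 0" "\<gamma>' > 0" and ratio: "\<psi> * t / s \<le> 1 + 1 / \<psi>"
    and \<gamma>': "\<gamma>' \<le> \<gamma>" "\<gamma>' \<le> \<beta> * \<delta>" and \<gamma>: "\<gamma> > 0"
    and w: "w = ((\<psi> - 1) / \<psi>) *\<^sub>R x + (1 / \<psi>) *\<^sub>R w0"
    and w': "w' = ((\<psi> - 1) / \<psi>) *\<^sub>R x' + (1 / \<psi>) *\<^sub>R w"
    and A: "Gx' + ((1 / t) *\<^sub>R (w - t *\<^sub>R (transpose K *v y') - x')) \<bullet> (xb - x')
        + \<gamma> / 2 * (norm (xb - x'))\<^sup>2 \<le> Gxb"
    and B: "Gx + ((1 / s) *\<^sub>R (w0 - s *\<^sub>R (transpose K *v y) - x)) \<bullet> (x' - x)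
        + \<gamma> / 2 * (norm (x' - x))\<^sup>2 \<le> Gx'"
    and C: "Fy' + ((1 / (\<beta> * t)) *\<^sub>R (y + (\<beta> * t) *\<^sub>R (K *v x) - y')) \<bullet> (yb - y')
        + \<delta> / 2 * (norm (yb - y'))\<^sup>2 \<le> Fyb"
    and LS: "sqrt (\<beta> * t) * norm (transpose K *v y' - transpose K *v y) \<le> sqrt (\<psi> / s) * norm (y' - y)"
  shows "(1 + t * \<gamma>') * (\<psi> / (\<psi> - 1) * (norm (w' - xb))\<^sup>2 + 1 / \<beta> * (norm (y' - yb))\<^sup>2)
      + 2 * t * (Gx + (K *v x) \<bullet> yb - Fyb - (Gxb + (K *v xb) \<bullet> y' - Fy'))
    \<le> (1 + t * \<gamma>' / \<psi>) * (\<psi> / (\<psi> - 1) * (norm (w - xb))\<^sup>2 + 1 / \<beta> * (norm (y - yb))\<^sup>2)"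
proof -
  define \<kappa> where "\<kappa> = \<psi> * t / s"
  have \<kappa>: "\<kappa> > 0" using pos by (simp add: \<kappa>_def)
  let ?T = "\<lambda>y. transpose K *v y"
  have A1: "t * (Gx' - Gxb) \<le> (x' - w) \<bullet> (xb - x') + t * (?T y' \<bullet> (xb - x')) - t * \<gamma> / 2 * (norm (x' - xb))\<^sup>2"
  proof -
    have "t * (Gx' + ((1 / t) *\<^sub>R (w - t *\<^sub>R ?T y' - x')) \<bullet> (xb - x')
        + \<gamma> / 2 * (norm (xb - x'))\<^sup>2) \<le> t * Gxb"
      using A pos by (intro mult_left_mono) auto
    then show ?thesis
      using pos by (simp add: inner_diff_left distrib_left right_diff_distrib norm_minus_commute[of xb]
          del: transpose_matrix_vector scaleR_diff_right)
  qed
  \<comment> \<open>The averaging step expresses the old centre \<open>w0\<close> through the new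
    \<open>w\<close>; its factor \<open>\<psi>\<close> is the one in
    \<open>\<kappa>\<close>.\<close>
  have "x - w0 = \<psi> *\<^sub>R (x - w)"
    using pos by (simp add: w algebra_simps diff_divide_distrib)
  then have xw0: "(w0 - s *\<^sub>R ?T y - x) \<bullet> (x' - x) = - (\<psi> * ((x - w) \<bullet> (x' - x))) - s * (?T y \<bullet> (x' - x))"
    by (smt (verit) inner_diff_left inner_scaleR_left)
  have B1: "t * (Gx - Gx') \<le> \<kappa> * ((x - w) \<bullet> (x' - x)) + t * (?T y \<bullet> (x' - x))"
  proof -
    have "t * (Gx + ((1 / s) *\<^sub>R (w0 - s *\<^sub>R ?T y - x)) \<bullet> (x' - x)) \<le> t * Gx'"
    proof (rule mult_left_mono)
      have "0 \<le> \<gamma> / 2 * (norm (x' - x))\<^sup>2" using \<gamma> by simp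
      with B show "Gx + ((1 / s) *\<^sub>R (w0 - s *\<^sub>R ?T y - x)) \<bullet> (x' - x) \<le> Gx'" by linarith
    qed (use pos in auto)
    then show ?thesis
      unfolding inner_scaleR_left xw0 \<kappa>_def using pos
      by (simp add: distrib_left right_diff_distrib diff_divide_distrib mult.commute[of \<psi> t]
          del: transpose_matrix_vector)
  qed
  have C1: "t * (Fy' - Fyb) \<le> 1 / \<beta> * ((y' - y) \<bullet> (yb - y')) - t * ((K *v x) \<bullet> (yb - y'))
      - t * \<delta> / 2 * (norm (y' - yb))\<^sup>2"
  proof -
    have "t * (Fy' + ((1 / (\<beta> * t)) *\<^sub>R (y + (\<beta> * t) *\<^sub>R (K *v x) - y')) \<bullet> (yb - y')
        + \<delta> / 2 * (norm (yb - y'))\<^sup>2) \<le> t * Fyb"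
      using C pos by (intro mult_left_mono) auto
    moreover have "t * (((1 / (\<beta> * t)) *\<^sub>R (y + (\<beta> * t) *\<^sub>R (K *v x) - y')) \<bullet> (yb - y'))
       = - (1 / \<beta> * ((y' - y) \<bullet> (yb - y'))) + t * ((K *v x) \<bullet> (yb - y'))"
      unfolding inner_scaleR_left inner_diff_left[of _ _ "yb - y'"] inner_add_left
      using pos by (simp add: field_simps)
    ultimately show ?thesis
      by (simp add: distrib_left right_diff_distrib norm_minus_commute[of yb])
  qed
  \<comment> \<open>Squaring the linesearch test bounds \<open>t * e\<close> by the dual increment;
    Young's inequality with weight \<open>\<kappa>\<close> then splits the product so that both
    squares cancel in \<open>core\<close>.\<close>
  have cross: "- 2 * t * ((?T y' - ?T y) \<bullet> (x' - x)) \<le> \<kappa> * (norm (x' - x))\<^sup>2 + 1 / \<beta> * (norm (y' - y))\<^sup>2"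
  proof -
    define e where "e = norm (?T y' - ?T y)"
    have "(sqrt (\<beta> * t) * e)\<^sup>2 \<le> (sqrt (\<psi> / s) * norm (y' - y))\<^sup>2"
      unfolding e_def using pos by (intro power_mono[OF LS] mult_nonneg_nonneg) auto
    then have "\<beta> * t * e\<^sup>2 \<le> \<psi> / s * (norm (y' - y))\<^sup>2"
      using pos by (simp add: power_mult_distrib)
    then have e: "t * t * e\<^sup>2 \<le> \<kappa> * (1 / \<beta> * (norm (y' - y))\<^sup>2)"
      using pos by (simp add: \<kappa>_def field_simps)
    have "- ((?T y' - ?T y) \<bullet> (x' - x)) \<le> e * norm (x' - x)"
      using norm_cauchy_schwarz[of "- (?T y' - ?T y)" "x' - x"]
      unfolding e_def inner_minus_left norm_minus_cancel .
    then have "(2 * t) * - ((?T y' - ?T y) \<bullet> (x' - x)) \<le> (2 * t) * (e * norm (x' - x))"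
      using pos by (intro mult_left_mono) auto
    then have "- 2 * t * ((?T y' - ?T y) \<bullet> (x' - x)) \<le> 2 * t * (e * norm (x' - x))"
      by (simp only: mult_minus_left mult_minus_right)
    also have "\<dots> \<le> \<kappa> * (norm (x' - x))\<^sup>2 + (t * e)\<^sup>2 / \<kappa>"
    proof -
      have "0 \<le> (sqrt \<kappa> * norm (x' - x) - t * e / sqrt \<kappa>)\<^sup>2" by simp
      also have "\<dots> = \<kappa> * (norm (x' - x))\<^sup>2 + (t * e)\<^sup>2 / \<kappa> - 2 * t * (e * norm (x' - x))"
        using \<kappa> by (simp add: power2_diff power_mult_distrib power_divide)
      finally show ?thesis by simp
    qed
    also have "(t * e)\<^sup>2 / \<kappa> \<le> 1 / \<beta> * (norm (y' - y))\<^sup>2"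
      using e \<kappa> by (simp add: divide_le_eq power2_eq_square mult_ac)
    finally show ?thesis by simp
  qed
  define P R S D where "P = (norm (x' - xb))\<^sup>2" and "R = (norm (w - x'))\<^sup>2" and "S = (norm (x - w))\<^sup>2"
    and "D = Gx + (K *v x) \<bullet> yb - Fyb - (Gxb + (K *v xb) \<bullet> y' - Fy')"
  define a a' b b' where "a = (norm (w - xb))\<^sup>2" and "a' = (norm (w' - xb))\<^sup>2"
    and "b = (norm (y - yb))\<^sup>2" and "b' = (norm (y' - yb))\<^sup>2"
  \<comment> \<open>All coupling terms reduce to those of the gap \<open>D\<close>, apart from one
    product of increments.\<close>
  have bilinear: "?T y' \<bullet> (xb - x') + ?T y \<bullet> (x' - x) - (K *v x) \<bullet> (yb - y')
      = (K *v xb) \<bullet> y' - (K *v x) \<bullet> yb - (?T y' - ?T y) \<bullet> (x' - x)"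
    by (simp add: inner_diff_left inner_diff_right transpose_inner inner_commute[of y']
        del: transpose_matrix_vector)
  have "t * D + t * \<gamma> / 2 * P + t * \<delta> / 2 * b'
     \<le> (x' - w) \<bullet> (xb - x') + \<kappa> * ((x - w) \<bullet> (x' - x)) + 1 / \<beta> * ((y' - y) \<bullet> (yb - y'))
       - t * ((?T y' - ?T y) \<bullet> (x' - x))"
    using A1 B1 C1 arg_cong[OF bilinear, of "(*) t"]
    unfolding D_def P_def b'_def by (simp add: distrib_left right_diff_distrib del: transpose_matrix_vector)
  then have "2 * (t * D) + t * \<gamma> * P + t * \<delta> * b'
     \<le> 2 * ((x' - w) \<bullet> (xb - x')) + \<kappa> * (2 * ((x - w) \<bullet> (x' - x)))
       + 1 / \<beta> * (2 * ((y' - y) \<bullet> (yb - y'))) + (\<kappa> * (norm (x' - x))\<^sup>2 + 1 / \<beta> * (norm (y' - y))\<^sup>2)"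
    using cross by (simp del: transpose_matrix_vector)
  then have core: "2 * (t * D) + t * \<gamma> * P + t * \<delta> * b'
     \<le> a - R - P + \<kappa> * (R - S) + 1 / \<beta> * b - 1 / \<beta> * b'"
    unfolding double_inner a_def R_def P_def S_def b_def b'_def
      norm_minus_commute[of x' w] norm_minus_commute[of x x']
    by (simp add: right_diff_distrib diff_divide_distrib)
  \<comment> \<open>Replaces the distance of \<open>x'\<close> by distances of \<open>w\<close> and
    \<open>w'\<close>, which is the source of the weight \<open>\<psi> / (\<psi> - 1)\<close> in the
    energy.\<close>
  have id: "\<psi> / (\<psi> - 1) * a' = P + 1 / (\<psi> - 1) * a - 1 / \<psi> * R"
    using norm_convex_comb_sq[OF pos(1), of x' xb w] unfolding a'_def P_def a_def R_def w' by simp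
  have nn: "P \<ge> 0" "R \<ge> 0" "S \<ge> 0" "a \<ge> 0" "b \<ge> 0" "b' \<ge> 0"
    by (simp_all add: P_def R_def S_def a_def b_def b'_def)
  have 1: "t * \<gamma>' * P \<le> t * \<gamma> * P" using \<gamma>' pos nn by (intro mult_right_mono mult_left_mono) auto
  have 2: "t * \<gamma>' * (1 / \<beta> * b') \<le> t * \<delta> * b'"
  proof -
    have "\<gamma>' * (1 / \<beta>) \<le> \<delta>" using \<gamma>'(2) pos by (simp add: divide_le_eq mult.commute)
    then have "(t * b') * (\<gamma>' * (1 / \<beta>)) \<le> (t * b') * \<delta>" using pos nn by (intro mult_left_mono) auto
    then show ?thesis by (simp add: mult_ac)
  qed
  \<comment> \<open>The growth cap on the step size enters here: \<open>\<kappa> * R - R\<close> is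
    at most \<open>1 / \<psi> * R\<close>, exactly what \<open>id\<close> supplies.\<close>
  have 3: "\<kappa> * R \<le> (1 + 1 / \<psi>) * R" using ratio nn unfolding \<kappa>_def by (intro mult_right_mono)
  have 4: "0 \<le> \<kappa> * S" "0 \<le> t * \<gamma>' * (1 / \<psi> * R)" "0 \<le> t * \<gamma>' / \<psi> * (1 / \<beta> * b)"
    using \<kappa> pos nn by auto
  \<comment> \<open>Since only the part \<open>1 / (\<psi> - 1)\<close> of the weight of
    \<open>a\<close> is multiplied by \<open>1 + t * \<gamma>'\<close>, the resulting factor is
    \<open>1 + t * \<gamma>' / \<psi>\<close>, the source of the contraction.\<close>
  have 5: "a + (1 + t * \<gamma>') * (1 / (\<psi> - 1) * a) = (1 + t * \<gamma>' / \<psi>) * (\<psi> / (\<psi> - 1) * a)"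
  proof -
    have "1 + (1 + t * \<gamma>') * (1 / (\<psi> - 1)) = (1 + t * \<gamma>' / \<psi>) * (\<psi> / (\<psi> - 1))"
      using pos by (simp add: divide_simps)
    then have "(1 + (1 + t * \<gamma>') * (1 / (\<psi> - 1))) * a = (1 + t * \<gamma>' / \<psi>) * (\<psi> / (\<psi> - 1)) * a" by simp
    then show ?thesis by (simp only: distrib_right mult_1_left mult.assoc)
  qed
  have "(1 + t * \<gamma>') * (\<psi> / (\<psi> - 1) * a' + 1 / \<beta> * b') + 2 * (t * D)
    = (P + t * \<gamma>' * P) + (1 + t * \<gamma>') * (1 / (\<psi> - 1) * a) - 1 / \<psi> * R - t * \<gamma>' * (1 / \<psi> * R)
      + 1 / \<beta> * b' + t * \<gamma>' * (1 / \<beta> * b') + 2 * (t * D)"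
    unfolding id by (simp only: distrib_left distrib_right right_diff_distrib mult_1_left)
  also have "\<dots> \<le> a + (1 + t * \<gamma>') * (1 / (\<psi> - 1) * a) + 1 / \<beta> * b + t * \<gamma>' / \<psi> * (1 / \<beta> * b)"
    using core 1 2 3 4 unfolding right_diff_distrib distrib_right mult_1_left by linarith
  also have "\<dots> = (1 + t * \<gamma>' / \<psi>) * (\<psi> / (\<psi> - 1) * a + 1 / \<beta> * b)"
    unfolding 5 by (simp only: distrib_left distrib_right mult_1_left)
  finally show ?thesis unfolding a_def a'_def b_def b'_def D_def by (simp add: mult.assoc)
qed

section \<open>Step sizes and rates\<close>

text \<open>The step size may become arbitrarily small, but only after it has been correspondingly
  large for a comparable number of iterations: the potential \<open>V\<close> pays for this.\<close>

lemma frequent_large_steps: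
  fixes \<tau> :: "nat \<Rightarrow> real"
  assumes \<phi>: "\<phi> > 1" and c: "c > 0" and pos: "\<And>n. \<tau> n > 0"
    and up: "\<And>n. \<tau> (Suc n) \<le> \<phi> * \<tau> n"
    and dich: "\<And>n. \<tau> (Suc n) = \<phi> * \<tau> n \<or> c \<le> \<tau> (Suc n) * \<tau> n"
  obtains T c0 where "T > 0" "\<And>N. real N \<le> 2 * real (card {j \<in> {1..N}. T \<le> \<tau> j}) + c0"
proof -
  \<comment> \<open>With \<open>T * T = c / \<phi>\<close> and \<open>u = ln (\<tau> / T)\<close>,
    the dichotomy becomes additive: either \<open>u\<close> grows by \<open>l\<close>, or two
    consecutive values sum to at least \<open>l\<close>.\<close>
  define T where "T = sqrt (c / \<phi>)"
  have T: "T > 0" "T * T = c / \<phi>" using \<phi> c by (simp_all add: T_def)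
  define l where "l = ln \<phi>"
  have l: "l > 0" using \<phi> by (simp add: l_def)
  define u where "u n = ln (\<tau> n / T)" for n
  define V where "V n = \<bar>u n - l\<bar>" for n
  have u_up: "u (Suc n) \<le> u n + l" for n
  proof -
    have "ln (\<tau> (Suc n) / T) \<le> ln (\<phi> * (\<tau> n / T))"
      using up[of n] pos[of n] pos[of "Suc n"] T(1) \<phi> by (simp add: divide_right_mono)
    also have "\<dots> = ln (\<tau> n / T) + ln \<phi>"
      using pos[of n] T(1) \<phi> by (subst ln_mult_pos) auto
    finally show ?thesis by (simp add: u_def l_def)
  qed
  have u_dich: "u (Suc n) = u n + l \<or> (l \<le> u (Suc n) + u n)" for n
    using dich[of n]
  proof
    assume "\<tau> (Suc n) = \<phi> * \<tau> n"
    then have "ln (\<tau> (Suc n) / T) = ln (\<phi> * (\<tau> n / T))" by simp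
    also have "\<dots> = ln (\<tau> n / T) + ln \<phi>"
      using pos[of n] T(1) \<phi> by (subst ln_mult_pos) auto
    finally show ?thesis by (simp add: u_def l_def)
  next
    assume "c \<le> \<tau> (Suc n) * \<tau> n"
    then have "\<phi> * (T * T) \<le> \<tau> (Suc n) * \<tau> n" using T(2) \<phi> by simp
    then have "\<phi> \<le> (\<tau> (Suc n) / T) * (\<tau> n / T)" using T(1) by (simp add: pos_le_divide_eq)
    then have "ln \<phi> \<le> ln ((\<tau> (Suc n) / T) * (\<tau> n / T))"
      using \<phi> by (intro ln_mono) auto
    also have "\<dots> = ln (\<tau> (Suc n) / T) + ln (\<tau> n / T)"
      using pos[of n] pos[of "Suc n"] T(1) by (subst ln_mult_pos) auto
    finally show ?thesis by (simp add: u_def l_def)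
  qed
  have large: "T \<le> \<tau> n \<longleftrightarrow> 0 \<le> u n" for n
    using pos[of n] T(1) by (simp add: u_def)
  have V_large: "V (Suc n) \<le> V n + l" if "T \<le> \<tau> n" for n
    using that u_up[of n] u_dich[of n] l unfolding large V_def by linarith
  \<comment> \<open>For \<open>u n < 0\<close> the second alternative would contradict the growth
    cap, so \<open>u\<close> rises by exactly \<open>l\<close> towards \<open>l\<close>.\<close>
  have V_small: "V (Suc n) \<le> V n - l" if "\<not> T \<le> \<tau> n" for n
    using that u_up[of n] u_dich[of n] l unfolding large V_def by linarith
  define H where "H N = real (card {j \<in> {1..N}. T \<le> \<tau> j})" for N
  have H_Suc: "H (Suc N) = H N + (if T \<le> \<tau> (Suc N) then 1 else 0)" for N
  proof -
    have "{j \<in> {1..Suc N}. T \<le> \<tau> j}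
      = (if T \<le> \<tau> (Suc N) then insert (Suc N) {j \<in> {1..N}. T \<le> \<tau> j} else {j \<in> {1..N}. T \<le> \<tau> j})"
      by (auto simp: le_Suc_eq)
    then show ?thesis by (simp add: H_def)
  qed
  have "V (Suc N) + l * (real N - H N) \<le> V 1 + l * H N" for N
  proof (induction N)
    case 0
    show ?case by (simp add: H_def)
  next
    case (Suc N)
    then show ?case
      using V_large[of "Suc N"] V_small[of "Suc N"] unfolding H_Suc
      by (auto simp: algebra_simps split: if_splits)
  qed
  moreover have "V n \<ge> 0" for n by (simp add: V_def)
  ultimately have *: "l * (real N - H N) \<le> V 1 + l * H N" for N
    by (meson add_increasing order_trans order_refl)
  have "real N \<le> 2 * H N + V 1 / l" for N
  proof -
    have "l * real N \<le> l * (2 * H N + V 1 / l)"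
      using *[of N] l by (simp add: algebra_simps)
    then show ?thesis using l by simp
  qed
  then show thesis using that T(1) unfolding H_def by blast
qed

text \<open>The factor \<open>(1 + t * \<gamma> / \<psi>) / (1 + t * \<gamma>)\<close> decreases in
  \<open>t\<close>, so each step of size at least \<open>T\<close> contracts by
  \<open>\<rho>\<close> while the others do not increase \<open>E\<close>. For
  \<open>\<Gamma>\<close>, the last large step up to \<open>N\<close> supplies the index.\<close>

lemma linear_convergence:
  fixes E \<Gamma> \<tau> :: "nat \<Rightarrow> real"
  assumes \<psi>: "\<psi> > 1" and \<gamma>: "\<gamma> > 0" and pos: "\<And>n. \<tau> n > 0"
    and E: "\<And>n. E n \<ge> 0" and \<Gamma>: "\<And>n. \<Gamma> (Suc n) \<ge> 0"
    and step: "\<And>k. (1 + \<tau> (Suc k) * \<gamma>) * E (Suc k) + 2 * \<tau> (Suc k) * \<Gamma> (Suc k)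
      \<le> (1 + \<tau> (Suc k) * \<gamma> / \<psi>) * E k"
    and T: "T > 0" and count: "\<And>N. real N \<le> 2 * real (card {j \<in> {1..N}. T \<le> \<tau> j}) + c0"
  obtains M \<theta> where "M > 0" "\<theta> > 1" "\<And>n. E n \<le> M / \<theta> ^ n"
    "\<And>N. N \<ge> 1 \<Longrightarrow> \<exists>n\<in>{1..N}. \<Gamma> n \<le> M / \<theta> ^ N"
proof -
  define \<rho> where "\<rho> = (1 + T * \<gamma> / \<psi>) / (1 + T * \<gamma>)"
  have \<psi>\<gamma>: "\<gamma> / \<psi> < \<gamma>" "\<gamma> / \<psi> > 0" using \<psi> \<gamma> by (auto simp: divide_less_eq)
  have \<rho>: "0 < \<rho>" "\<rho> < 1"
    using mult_strict_left_mono[OF \<psi>\<gamma>(1) T] mult_pos_pos[OF T \<psi>\<gamma>(2)] mult_pos_pos[OF T \<gamma>]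
    by (auto simp: \<rho>_def divide_less_eq intro!: divide_pos_pos)
  have contr: "(1 + \<tau> (Suc k) * \<gamma>) * E (Suc k) \<le> (1 + \<tau> (Suc k) * \<gamma> / \<psi>) * E k" for k
    using step[of k] pos[of "Suc k"] \<Gamma>[of k] by (smt (verit) mult_nonneg_nonneg)
  have den: "1 + \<tau> k * \<gamma> > 0" for k
    using pos[of k] \<gamma> by (simp add: add_pos_pos)
  have E_Suc: "E (Suc k) \<le> E k" for k
  proof -
    have "\<tau> (Suc k) * \<gamma> / \<psi> \<le> \<tau> (Suc k) * \<gamma>"
      using mult_left_mono[OF less_imp_le[OF \<psi>\<gamma>(1)], of "\<tau> (Suc k)"] pos[of "Suc k"] by simp
    then have "(1 + \<tau> (Suc k) * \<gamma> / \<psi>) * E k \<le> (1 + \<tau> (Suc k) * \<gamma>) * E k"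
      using E[of k] by (intro mult_right_mono) auto
    with contr[of k] have "(1 + \<tau> (Suc k) * \<gamma>) * E (Suc k) \<le> (1 + \<tau> (Suc k) * \<gamma>) * E k"
      by linarith
    then show ?thesis using den[of "Suc k"] by simp
  qed
  have E_Suc_large: "E (Suc k) \<le> \<rho> * E k" if "T \<le> \<tau> (Suc k)" for k
  proof -
    define s t p where "s = \<tau> (Suc k) * \<gamma>" and "t = T * \<gamma>" and "p = 1 / \<psi>"
    have "t * (1 - p) \<le> s * (1 - p)"
      using that \<gamma> \<psi> by (intro mult_right_mono) (auto simp: s_def t_def p_def)
    then have "(1 + s * p) * (1 + t) \<le> (1 + t * p) * (1 + s)" by (simp add: algebra_simps)
    moreover have "1 + t > 0" using T \<gamma> by (simp add: t_def add_pos_pos)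
    ultimately have "1 + s * p \<le> (1 + t * p) / (1 + t) * (1 + s)" by (simp add: pos_le_divide_eq)
    then have "1 + \<tau> (Suc k) * \<gamma> / \<psi> \<le> \<rho> * (1 + \<tau> (Suc k) * \<gamma>)"
      by (simp add: \<rho>_def s_def t_def p_def)
    then have "(1 + \<tau> (Suc k) * \<gamma> / \<psi>) * E k \<le> \<rho> * (1 + \<tau> (Suc k) * \<gamma>) * E k"
      using E[of k] by (intro mult_right_mono) auto
    with contr[of k] have "(1 + \<tau> (Suc k) * \<gamma>) * E (Suc k) \<le> (1 + \<tau> (Suc k) * \<gamma>) * (\<rho> * E k)"
      by (simp add: mult_ac)
    then show ?thesis using den[of "Suc k"] by simp
  qed
  define H where "H N = card {j \<in> {1..N}. T \<le> \<tau> j}" for N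
  have H_Suc: "H (Suc N) = (if T \<le> \<tau> (Suc N) then Suc (H N) else H N)" for N
  proof -
    have "{j \<in> {1..Suc N}. T \<le> \<tau> j}
      = (if T \<le> \<tau> (Suc N) then insert (Suc N) {j \<in> {1..N}. T \<le> \<tau> j} else {j \<in> {1..N}. T \<le> \<tau> j})"
      by (auto simp: le_Suc_eq)
    then show ?thesis by (simp add: H_def)
  qed
  have E_bound: "E n \<le> \<rho> ^ H n * E 0" for n
  proof (induction n)
    case 0
    show ?case by (simp add: H_def)
  next
    case (Suc n)
    show ?case
    proof (cases "T \<le> \<tau> (Suc n)")
      case True
      have "E (Suc n) \<le> \<rho> * (\<rho> ^ H n * E 0)"
        using E_Suc_large[OF True] mult_left_mono[OF Suc, of \<rho>] \<rho> by linarith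
      then show ?thesis using True by (simp add: H_Suc mult.assoc)
    next
      case False
      then show ?thesis using E_Suc[of n] Suc by (simp add: H_Suc)
    qed
  qed
  \<comment> \<open>Dividing the energy inequality by twice the step size leaves
    \<open>1 / (2 * t) + \<gamma> / (2 * \<psi>)\<close>, which is at most \<open>D\<close> for
    \<open>t\<close> at least \<open>T\<close>.\<close>
  define D where "D = 1 / (2 * T) + \<gamma>"
  have \<Gamma>_large: "\<Gamma> (Suc k) \<le> D * E k" if "T \<le> \<tau> (Suc k)" for k
  proof -
    let ?t = "\<tau> (Suc k)"
    have "2 * ?t * \<Gamma> (Suc k) \<le> (1 + ?t * (\<gamma> / \<psi>)) * E k"
      using step[of k] den[of "Suc k"] E[of "Suc k"] by (smt (verit) mult_nonneg_nonneg times_divide_eq_right)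
    also have "\<dots> \<le> (2 * ?t * D) * E k"
    proof (intro mult_right_mono E)
      have "1 \<le> ?t / T" using that T by simp
      moreover have "?t * (\<gamma> / \<psi>) \<le> ?t * \<gamma>"
        using pos[of "Suc k"] \<psi>\<gamma> by (intro mult_left_mono) auto
      moreover have "0 \<le> ?t * \<gamma>" using pos[of "Suc k"] \<gamma> by simp
      moreover have "2 * ?t * D = ?t / T + 2 * (?t * \<gamma>)"
        by (simp add: D_def distrib_left)
      ultimately show "1 + ?t * (\<gamma> / \<psi>) \<le> 2 * ?t * D" by linarith
    qed
    finally have "?t * \<Gamma> (Suc k) \<le> ?t * (D * E k)" by simp
    then show ?thesis using pos[of "Suc k"] by simp
  qed
  \<comment> \<open>The division by \<open>\<rho>\<close> pays for the lag of one contraction, as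
    \<open>\<Gamma>\<close> is bounded by the energy before the step. The first gap is included
    because step 1 may be small.\<close>
  define C where "C = (\<Gamma> (Suc 0) + D * E 0 + E 0 + 1) / \<rho>"
  have D: "D > 0" using T \<gamma> by (simp add: D_def add_pos_pos)
  have C: "C > 0" "D * E 0 \<le> \<rho> * C" "E 0 \<le> C" "\<Gamma> (Suc 0) \<le> \<rho> * C"
  proof -
    have \<rho>C: "\<rho> * C = \<Gamma> (Suc 0) + D * E 0 + E 0 + 1" using \<rho> by (simp add: C_def)
    have DE: "D * E 0 \<ge> 0" using D E[of 0] by simp
    show "D * E 0 \<le> \<rho> * C" "\<Gamma> (Suc 0) \<le> \<rho> * C"
      using \<rho>C \<Gamma>[of 0] E[of 0] DE by linarith+
    have "\<rho> * C > 0" using \<rho>C \<Gamma>[of 0] E[of 0] DE by linarith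
    then show "C > 0" using \<rho> by (simp add: zero_less_mult_iff)
    then have "\<rho> * C \<le> C" using \<rho> by simp
    then show "E 0 \<le> C" using \<rho>C \<Gamma>[of 0] E[of 0] DE by linarith
  qed
  \<comment> \<open>At a small step neither the index nor \<open>H\<close> changes.\<close>
  have \<Gamma>_bound: "\<exists>n\<in>{1..Suc N}. \<Gamma> n \<le> C * \<rho> ^ H (Suc N)" for N
  proof (induction N)
    case 0
    have "H (Suc 0) \<le> 1" by (simp add: H_Suc) (simp add: H_def)
    then have "\<rho> ^ 1 \<le> \<rho> ^ H (Suc 0)" using \<rho> by (intro power_decreasing) auto
    then have "C * \<rho> \<le> C * \<rho> ^ H (Suc 0)" using C(1) by simp
    then show ?case using C(4) by (auto simp: mult.commute)
  next
    case (Suc N)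
    show ?case
    proof (cases "T \<le> \<tau> (Suc (Suc N))")
      case True
      have "\<Gamma> (Suc (Suc N)) \<le> D * E (Suc N)" using \<Gamma>_large[OF True] .
      also have "\<dots> \<le> D * (\<rho> ^ H (Suc N) * E 0)" using E_bound D by simp
      also have "\<dots> = \<rho> ^ H (Suc N) * (D * E 0)" by simp
      also have "\<dots> \<le> \<rho> ^ H (Suc N) * (\<rho> * C)" using C(2) \<rho> by simp
      also have "\<dots> = C * \<rho> ^ H (Suc (Suc N))" using True by (simp add: H_Suc[of "Suc N"])
      finally show ?thesis by auto
    next
      case False
      then have "H (Suc (Suc N)) = H (Suc N)" by (simp add: H_Suc[of "Suc N"])
      then show ?thesis using Suc by auto
    qed
  qed
  \<comment> \<open>At least \<open>(n - c0) / 2\<close> of the first \<open>n\<close> steps are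
    large: the half gives the exponent of \<open>\<theta>\<close>, and the offset \<open>c0\<close>
    goes into \<open>M\<close>.\<close>
  define \<theta> where "\<theta> = \<rho> powr (- 1 / 2)"
  define M where "M = C * \<rho> powr (- c0 / 2)"
  have \<theta>: "\<theta> > 1"
    using powr_less_mono'[of \<rho> "- 1 / 2" 0] \<rho> by (simp add: \<theta>_def)
  have rate: "C * \<rho> ^ H n \<le> M / \<theta> ^ n" for n
  proof -
    have "\<rho> ^ H n = \<rho> powr real (H n)" using \<rho> by (simp add: powr_realpow)
    also have "\<dots> \<le> \<rho> powr ((real n - c0) / 2)"
      using \<rho> count[of n] by (intro powr_mono') (auto simp: H_def)
    also have "\<dots> = \<rho> powr (- c0 / 2) / (\<rho> powr (- 1 / 2)) powr real n"
      unfolding powr_powr powr_diff[symmetric] by (simp add: diff_divide_distrib)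
    also have "\<dots> = \<rho> powr (- c0 / 2) / \<theta> ^ n"
      using \<rho> by (simp add: \<theta>_def powr_realpow)
    finally show ?thesis using C(1) by (simp add: M_def mult_left_mono flip: times_divide_eq_right)
  qed
  show thesis
  proof (rule that[OF _ \<theta>])
    show "M > 0" using C(1) \<rho> by (simp add: M_def)
    fix n
    have "E n \<le> C * \<rho> ^ H n"
      using order_trans[OF E_bound[of n] mult_left_mono[OF C(3)]] \<rho>
      by (simp add: mult.commute[of C])
    with rate show "E n \<le> M / \<theta> ^ n" by (rule order_trans[rotated])
  next
    fix N :: nat assume "N \<ge> 1"
    then obtain k where "N = Suc k" by (cases N) auto
    then show "\<exists>n\<in>{1..N}. \<Gamma> n \<le> M / \<theta> ^ N"
      using \<Gamma>_bound[of k] rate[of N] by (meson order_trans)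
  qed
qed

text \<open>With \<open>L\<close> bounding the adjoint, the test follows from a bound on
  \<open>t * s\<close> alone, whence the role of products of consecutive step sizes.\<close>

lemma ls_accept_small:
  assumes L: "\<And>v. norm (transpose K *v v) \<le> L * norm v" "L > 0"
    and pos: "s > 0" "t > 0" "\<beta> > 0" "\<psi> > 0" and small: "t * s \<le> \<psi> / (\<beta> * L\<^sup>2)"
  shows "ls_accept f K \<psi> \<beta> s x y t"
proof -
  let ?d = "dual_step f K \<beta> x y t - y"
  have "norm (transpose K *v dual_step f K \<beta> x y t - transpose K *v y) \<le> L * norm ?d"
    using L(1)[of ?d] by (simp add: matrix_vector_mult_diff_distrib del: transpose_matrix_vector)
  then have "sqrt (\<beta> * t) * norm (transpose K *v dual_step f K \<beta> x y t - transpose K *v y)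
      \<le> sqrt (\<beta> * t) * (L * norm ?d)"
    using pos by (intro mult_left_mono) auto
  also have "\<dots> = sqrt (\<beta> * t * L\<^sup>2) * norm ?d" using L(2) by (simp add: real_sqrt_mult)
  also have "\<dots> \<le> sqrt (\<psi> / s) * norm ?d"
  proof (intro mult_right_mono real_sqrt_le_mono)
    show "\<beta> * t * L\<^sup>2 \<le> \<psi> / s"
      using small pos L(2) by (simp add: pos_le_divide_eq mult_ac)
  qed simp
  finally show ?thesis by (simp add: ls_accept_def)
qed

text \<open>Trial sizes decrease geometrically, so some trial meets the criterion of
  \<open>ls_accept_small\<close>. After any backtracking the previous trial, larger by the factor
  \<open>1 / \<mu>\<close>, was rejected and thus violated that criterion; this bounds
  \<open>t * s\<close> from below.\<close>

lemma linesearch_step: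
  fixes f :: "real^'p \<Rightarrow> ereal" and K :: "real^'q^'p"
  assumes L: "\<And>v. norm (transpose K *v v) \<le> L * norm v" "L > 0"
    and pos: "s > 0" "\<phi> > 0" "\<beta> > 0" "\<psi> > 0" and \<mu>: "0 < \<mu>" "\<mu> < 1"
    and t: "t = \<phi> * s * \<mu> ^ (LEAST i. ls_accept f K \<psi> \<beta> s x y (\<phi> * s * \<mu> ^ i))"
  shows "t > 0" and "t \<le> \<phi> * s" and "ls_accept f K \<psi> \<beta> s x y t"
    and "t = \<phi> * s \<or> \<mu> * \<psi> / (\<beta> * L\<^sup>2) \<le> t * s"
proof -
  let ?P = "\<lambda>i. ls_accept f K \<psi> \<beta> s x y (\<phi> * s * \<mu> ^ i)"
  define i where "i = (LEAST i. ?P i)"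
  have t: "t = \<phi> * s * \<mu> ^ i" using t by (simp add: i_def)
  have trial: "\<phi> * s * \<mu> ^ j > 0" for j using pos \<mu> by simp
  show "t > 0" using trial t by simp
  have "\<mu> ^ i \<le> 1" using \<mu> by (simp add: power_le_one)
  then show "t \<le> \<phi> * s" using pos by (simp add: t)
  have bound: "\<psi> / (\<beta> * L\<^sup>2) > 0" using pos L(2) by simp
  have \<phi>ss: "\<phi> * s * s > 0" using pos by simp
  obtain j where "\<mu> ^ j < \<psi> / (\<beta> * L\<^sup>2) / (\<phi> * s * s)"
    using real_arch_pow_inv[OF divide_pos_pos[OF bound \<phi>ss] \<mu>(2)] by blast
  then have "\<mu> ^ j * (\<phi> * s * s) < \<psi> / (\<beta> * L\<^sup>2)"
    unfolding pos_less_divide_eq[OF \<phi>ss] .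
  then have "\<phi> * s * \<mu> ^ j * s \<le> \<psi> / (\<beta> * L\<^sup>2)" by (simp add: mult_ac)
  then have "?P j" by (intro ls_accept_small[OF L pos(1) trial pos(3,4)])
  then have "?P i" unfolding i_def by (rule LeastI)
  then show "ls_accept f K \<psi> \<beta> s x y t" by (simp add: t)
  show "t = \<phi> * s \<or> \<mu> * \<psi> / (\<beta> * L\<^sup>2) \<le> t * s"
  proof (cases i)
    case 0
    then show ?thesis by (simp add: t)
  next
    case (Suc k)
    then have "\<not> ?P k" unfolding i_def by (metis lessI not_less_Least)
    then have "\<not> \<phi> * s * \<mu> ^ k * s \<le> \<psi> / (\<beta> * L\<^sup>2)"
      using ls_accept_small[OF L pos(1) trial[of k] pos(3,4)] by blast
    then have "\<mu> * (\<psi> / (\<beta> * L\<^sup>2)) \<le> \<mu> * (\<phi> * s * \<mu> ^ k * s)"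
      using \<mu> by (intro mult_left_mono) auto
    then show ?thesis using Suc by (simp add: t mult_ac)
  qed
qed

lemma sqrt_rate:
  fixes d e :: real
  assumes "\<theta> > 0" "0 \<le> d" "d\<^sup>2 \<le> M / \<theta> ^ n"
  shows "d \<le> sqrt M / sqrt \<theta> ^ n"
  using real_le_rsqrt[OF assms(3)] by (simp add: real_sqrt_divide real_sqrt_power)

lemma tendsto_of_rate:
  fixes u :: "nat \<Rightarrow> 'a::real_normed_vector"
  assumes "\<theta> > 1" "\<And>n. norm (u n - l) \<le> C / \<theta> ^ n"
  shows "u \<longlonglongrightarrow> l"
proof (rule LIM_zero_cancel, rule Lim_null_comparison)
  show "\<forall>\<^sub>F n in sequentially. norm (u n - l) \<le> C / \<theta> ^ n" using assms(2) by simp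
  show "(\<lambda>n. C / \<theta> ^ n) \<longlonglongrightarrow> 0"
    using LIMSEQ_divide_realpow_zero[OF assms(1)] .
qed

theorem theorem4p2:
  fixes g :: "real^'q \<Rightarrow> ereal" and f :: "real^'p \<Rightarrow> ereal" and K :: "real^'q^'p"
    and \<gamma>\<^sub>g \<gamma>\<^sub>f \<psi> \<beta> \<mu> :: real
    and z x :: "nat \<Rightarrow> real^'q" and y :: "nat \<Rightarrow> real^'p" and \<tau> :: "nat \<Rightarrow> real"
  assumes "closed_proper_convex g" and "closed_proper_convex f"
    and "primal_solutions g f K \<noteq> {}"
    and "\<exists>x'. x' \<in> rel_interior (eff_dom g) \<and> K *v x' \<in> rel_interior (eff_dom f)"
    and "\<gamma>\<^sub>g > 0" and "strongly_convex \<gamma>\<^sub>g g"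
    and "\<gamma>\<^sub>f > 0" and "strongly_convex \<gamma>\<^sub>f (conjugate f)"
    and "psi0 < \<psi>" and "\<psi> < golden_ratio"
    and "\<beta> > 0" and "\<tau> 0 > 0" and "0 < \<mu>" and "\<mu> < 1"
    and "grpda_linesearch g f K \<psi> \<beta> \<mu> z x y \<tau>"
  shows "\<exists>xbar ybar.
      saddle_points g f K = {(xbar, ybar)} \<and>
      primal_solutions g f K = {xbar} \<and> dual_solutions g f K = {ybar} \<and>
      (\<lambda>n. (z n, y n)) \<longlonglongrightarrow> (xbar, ybar) \<and>
      (\<exists>C1 > 0. \<exists>C2 > 0. \<exists>\<theta> > 1. \<forall>n \<ge> 1.
         norm (z (n + 2) - xbar) \<le> C1 / \<theta> ^ n \<and> norm (y n - ybar) \<le> C2 / \<theta> ^ n) \<and>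
      (\<exists>C3 > 0. \<exists>\<theta>' > 1. \<forall>N \<ge> 1.
         (MIN n\<in>{1..N}. pd_gap g f K xbar ybar (x n) (y n)) \<le> ereal (C3 / \<theta>' ^ N))"
proof -

  \<comment> \<open>The saddle point and the optimal solutions\<close>
  note g = assms(1) and f = assms(2) and \<gamma>g = assms(5) and scg = assms(6)
    and \<gamma>f = assms(7) and scf = assms(8) and \<beta> = assms(11) and \<mu> = assms(13,14)
  have f': "closed_proper_convex (conjugate f)" by (rule cpc_conjugate[OF f])
  obtain xb where xb: "xb \<in> primal_solutions g f K" using assms(3) by blast
  obtain yb where saddle: "(xb, yb) \<in> saddle_points g f K"
    using primal_solution_saddle_point[OF g f scf \<gamma>f xb] .
  note uniq = saddle_point_unique[OF g f scg \<gamma>g scf \<gamma>f _ saddle]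
  have saddle_eq: "saddle_points g f K = {(xb, yb)}"
  proof -
    have "w = (xb, yb)" if "w \<in> saddle_points g f K" for w
      using uniq[of "fst w" "snd w"] that by (simp add: prod_eq_iff)
    with saddle show ?thesis by blast
  qed
  have primal_eq: "primal_solutions g f K = {xb}"
  proof -
    have "v = xb" if v: "v \<in> primal_solutions g f K" for v
    proof -
      obtain w where "(v, w) \<in> saddle_points g f K"
        using primal_solution_saddle_point[OF g f scf \<gamma>f v] .
      with uniq show ?thesis by blast
    qed
    with xb show ?thesis by blast
  qed
  have dual_eq: "dual_solutions g f K = {yb}"
    by (rule saddle_point_dual[OF g f scf \<gamma>f saddle])

  \<comment> \<open>Parameters, step sizes and optimality conditions of the iterates\<close>
  have \<psi>: "\<psi> > 1" using psi0_gt_1 assms(9) by linarith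
  have \<psi>2: "\<psi>\<^sup>2 < 1 + \<psi>" using below_golden_ratio assms(10) \<psi> by simp
  define \<phi> where "\<phi> = (1 + \<psi>) / \<psi>\<^sup>2"
  have \<phi>: "\<phi> > 1" using \<psi> \<psi>2 by (simp add: \<phi>_def)
  have rec: "z (Suc n) = ((\<psi> - 1) / \<psi>) *\<^sub>R x n + (1 / \<psi>) *\<^sub>R z n"
    "x (Suc n) = prox (\<tau> n) g (z (Suc n) - \<tau> n *\<^sub>R (transpose K *v y n))"
    "\<tau> (Suc n) = \<phi> * \<tau> n *
      \<mu> ^ (LEAST i. ls_accept f K \<psi> \<beta> (\<tau> n) (x (Suc n)) (y n) (\<phi> * \<tau> n * \<mu> ^ i))"
    "y (Suc n) = dual_step f K \<beta> (x (Suc n)) (y n) (\<tau> (Suc n))" for n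
    using assms(15) by (simp_all add: grpda_linesearch_def Let_def \<phi>_def)
  obtain L where L: "\<And>v. norm (transpose K *v v) \<le> L * norm v" "L > 0"
    using bounded_linear.pos_bounded[OF matrix_vector_mul_bounded_linear[of "transpose K"]]
    by (metis mult.commute)
  have "\<phi> > 0" "\<psi> > 0" using \<phi> \<psi> by auto
  note ls = linesearch_step[OF L _ \<open>\<phi> > 0\<close> \<beta> \<open>\<psi> > 0\<close> \<mu> rec(3)]
  have \<tau>: "\<tau> n > 0" for n
    by (induction n) (auto simp: assms(12) intro: ls(1))
  define c where "c = \<mu> * \<psi> / (\<beta> * L\<^sup>2)"
  have c: "c > 0" using \<mu> \<psi> \<beta> L(2) by (simp add: c_def)
  obtain T c0 where T: "T > 0"
    and count: "\<And>N. real N \<le> 2 * real (card {j \<in> {1..N}. T \<le> \<tau> j}) + c0"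
    using frequent_large_steps[where \<tau> = \<tau>, OF \<phi> c \<tau> ls(2)[OF \<tau>] ls(4)[OF \<tau>, folded c_def]] by metis
  define G where "G v = real_of_ereal (g v)" for v
  define F where "F v = real_of_ereal (conjugate f v)" for v
  have sub: "- (transpose K *v yb) \<in> subdiff g xb" "K *v xb \<in> subdiff (conjugate f) yb"
    using saddle by (auto simp: saddle_points_iff)
  have Gxb: "g xb = ereal (G xb)" unfolding G_def by (rule subdiff_real[OF g sub(1)])
  have Fyb: "conjugate f yb = ereal (F yb)"
    unfolding F_def by (rule subdiff_real[OF f' sub(2)])
  have sx: "(1 / \<tau> n) *\<^sub>R (z (Suc n) - \<tau> n *\<^sub>R (transpose K *v y n) - x (Suc n)) \<in> subdiff g (x (Suc n))" for n
    unfolding rec(2)[of n] using prox_optimality[OF g \<tau>[of n]] .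
  have Gx: "g (x (Suc n)) = ereal (G (x (Suc n)))" for n
    unfolding G_def by (rule subdiff_real[OF g sx])
  have sy: "(1 / (\<beta> * \<tau> (Suc n))) *\<^sub>R (y n + (\<beta> * \<tau> (Suc n)) *\<^sub>R (K *v x (Suc n)) - y (Suc n))
      \<in> subdiff (conjugate f) (y (Suc n))" for n
    unfolding rec(4)[of n] dual_step_def using prox_optimality[OF f' mult_pos_pos[OF \<beta> \<tau>]] .
  have Fy: "conjugate f (y (Suc n)) = ereal (F (y (Suc n)))" for n
    unfolding F_def by (rule subdiff_real[OF f' sy])

  \<comment> \<open>The shift by 2 matches the scheme: \<open>z (n + 2)\<close> is formed from
    \<open>x (n + 1)\<close>, which is computed with \<open>y n\<close>.\<close>
  define E where "E n = \<psi> / (\<psi> - 1) * (norm (z (n + 2) - xb))\<^sup>2 + 1 / \<beta> * (norm (y n - yb))\<^sup>2" for n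
  \<comment> \<open>Real-valued form of the gap, used from index 1 on: prox points have finite
    function values, whereas the starting points need not.\<close>
  define \<Gamma> where "\<Gamma> n = G (x n) + (K *v x n) \<bullet> yb - F yb - (G xb + (K *v xb) \<bullet> y n - F (y n))" for n
  \<comment> \<open>The dual distance carries the weight \<open>1 / \<beta>\<close> in
    \<open>E\<close>, so \<open>\<gamma>\<^sub>f\<close> counts as
    \<open>\<beta> * \<gamma>\<^sub>f\<close>.\<close>
  define \<gamma> where "\<gamma> = min \<gamma>\<^sub>g (\<beta> * \<gamma>\<^sub>f)"
  have \<gamma>: "\<gamma> > 0" "\<gamma> \<le> \<gamma>\<^sub>g" "\<gamma> \<le> \<beta> * \<gamma>\<^sub>f" using \<gamma>g \<gamma>f \<beta> by (auto simp: \<gamma>_def)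
  have gap: "pd_gap g f K xb yb (x (Suc n)) (y (Suc n)) = ereal (\<Gamma> (Suc n))" for n
    by (simp add: pd_gap_def lagrangian_def Gx Gxb Fy Fyb \<Gamma>_def)
  have \<Gamma>: "\<Gamma> (Suc n) \<ge> 0" for n
  proof -
    have "0 \<le> \<gamma>\<^sub>g / 2 * (norm (x (Suc n) - xb))\<^sup>2" "0 \<le> \<gamma>\<^sub>f / 2 * (norm (y (Suc n) - yb))\<^sup>2"
      using \<gamma>g \<gamma>f by auto
    with strongly_convex_real[OF scg sub(1) Gxb Gx[of n]] strongly_convex_real[OF scf sub(2) Fyb Fy[of n]]
    show ?thesis
      by (simp add: \<Gamma>_def inner_diff_right inner_minus_left transpose_inner inner_commute[of yb]
          del: transpose_matrix_vector)
  qed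
  have step: "(1 + \<tau> (Suc k) * \<gamma>) * E (Suc k) + 2 * \<tau> (Suc k) * \<Gamma> (Suc k)
      \<le> (1 + \<tau> (Suc k) * \<gamma> / \<psi>) * E k" for k
  proof -
    have "\<tau> (Suc k) / \<tau> k \<le> \<phi>" using ls(2)[OF \<tau>] \<tau>[of k] by (simp add: divide_le_eq)
    then have "\<psi> * (\<tau> (Suc k) / \<tau> k) \<le> \<psi> * \<phi>"
      using \<psi> by (intro mult_left_mono) auto
    also have "\<psi> * \<phi> = 1 + 1 / \<psi>" using \<psi> by (simp add: \<phi>_def power2_eq_square field_simps)
    finally have ratio: "\<psi> * \<tau> (Suc k) / \<tau> k \<le> 1 + 1 / \<psi>" by simp
    have accept: "sqrt (\<beta> * \<tau> (Suc k)) * norm (transpose K *v y (Suc k) - transpose K *v y k)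
        \<le> sqrt (\<psi> / \<tau> k) * norm (y (Suc k) - y k)"
      using ls(3)[OF \<tau>, of k] unfolding ls_accept_def rec(4)[symmetric] .
    show ?thesis
      \<comment> \<open>The step runs one primal iterate ahead: it uses the inclusion at
        \<open>x (k + 2)\<close>, while the gap is taken at \<open>x (k + 1)\<close> and
        \<open>y (k + 1)\<close>.\<close>
      using grpda_energy_step[OF \<psi> \<tau>[of k] \<tau>[of "Suc k"] \<beta> \<gamma>(1) ratio \<gamma>(2,3) \<gamma>g
          rec(1)[of "Suc k"] rec(1)[of "Suc (Suc k)"]
          strongly_convex_real[OF scg sx Gx Gxb] strongly_convex_real[OF scg sx Gx Gx]
          strongly_convex_real[OF scf sy Fy Fyb] accept]
      unfolding E_def \<Gamma>_def by simp
  qed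
  have E: "E n \<ge> 0" for n using \<psi> \<beta> by (simp add: E_def)
  obtain M \<theta> where M: "M > 0" and \<theta>: "\<theta> > 1" and EM: "\<And>n. E n \<le> M / \<theta> ^ n"
    and \<Gamma>M: "\<And>N. N \<ge> 1 \<Longrightarrow> \<exists>n\<in>{1..N}. \<Gamma> n \<le> M / \<theta> ^ N"
    using linear_convergence[where \<tau> = \<tau> and E = E and \<Gamma> = \<Gamma>, OF \<psi> \<gamma>(1) \<tau> E \<Gamma> step T count] by metis

  \<comment> \<open>The energy is quadratic in the distances, so the iterates converge at rate
    \<open>sqrt \<theta>\<close>, while the gap keeps \<open>\<theta>\<close>.\<close>
  have z_rate: "norm (z (n + 2) - xb) \<le> sqrt M / sqrt \<theta> ^ n" for n
  proof (rule sqrt_rate)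
    have "1 * (norm (z (n + 2) - xb))\<^sup>2 \<le> \<psi> / (\<psi> - 1) * (norm (z (n + 2) - xb))\<^sup>2"
      using \<psi> by (intro mult_right_mono) auto
    also have "\<dots> \<le> E n" using \<beta> by (simp add: E_def)
    finally show "(norm (z (n + 2) - xb))\<^sup>2 \<le> M / \<theta> ^ n" using EM[of n] by simp
  qed (use \<theta> in auto)
  have y_rate: "norm (y n - yb) \<le> sqrt (\<beta> * M) / sqrt \<theta> ^ n" for n
  proof (rule sqrt_rate)
    have "1 / \<beta> * (norm (y n - yb))\<^sup>2 \<le> E n" using \<psi> by (simp add: E_def)
    also have "\<dots> \<le> M / \<theta> ^ n" by (rule EM)
    finally show "(norm (y n - yb))\<^sup>2 \<le> \<beta> * M / \<theta> ^ n"
      using \<beta> by (simp add: pos_divide_le_eq mult.commute)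
  qed (use \<theta> in auto)
  have \<theta>': "sqrt \<theta> > 1" using \<theta> by simp
  have z_lim: "(\<lambda>n. z (n + 2)) \<longlonglongrightarrow> xb" and y_lim: "y \<longlonglongrightarrow> yb"
    by (rule tendsto_of_rate[OF \<theta>' z_rate], rule tendsto_of_rate[OF \<theta>' y_rate])
  have lim: "(\<lambda>n. (z n, y n)) \<longlonglongrightarrow> (xb, yb)"
    by (rule tendsto_Pair[OF LIMSEQ_offset[OF z_lim] y_lim])
  have gap_rate: "(MIN n\<in>{1..N}. pd_gap g f K xb yb (x n) (y n)) \<le> ereal (M / \<theta> ^ N)" if N: "N \<ge> 1" for N
  proof -
    obtain n where n: "n \<in> {1..N}" "\<Gamma> n \<le> M / \<theta> ^ N" using \<Gamma>M[OF N] by blast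
    then have "pd_gap g f K xb yb (x n) (y n) = ereal (\<Gamma> n)" using gap[of "n - 1"] by simp
    moreover have "(MIN n\<in>{1..N}. pd_gap g f K xb yb (x n) (y n)) \<le> pd_gap g f K xb yb (x n) (y n)"
      using n(1) by (intro Min_le) auto
    ultimately show ?thesis using n(2) by (metis ereal_less_eq(3) order_trans)
  qed
  have pos: "sqrt M > 0" "sqrt (\<beta> * M) > 0" using M \<beta> by simp_all
  show ?thesis
  proof (intro exI conjI)
    show "saddle_points g f K = {(xb, yb)}" by (rule saddle_eq)
    show "primal_solutions g f K = {xb}" by (rule primal_eq)
    show "dual_solutions g f K = {yb}" by (rule dual_eq)
    show "(\<lambda>n. (z n, y n)) \<longlonglongrightarrow> (xb, yb)" by (rule lim)
    show "\<forall>n\<ge>1. norm (z (n + 2) - xb) \<le> sqrt M / sqrt \<theta> ^ n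
        \<and> norm (y n - yb) \<le> sqrt (\<beta> * M) / sqrt \<theta> ^ n"
      using z_rate y_rate by blast
    show "\<forall>N\<ge>1. (MIN n\<in>{1..N}. pd_gap g f K xb yb (x n) (y n)) \<le> ereal (M / \<theta> ^ N)"
      using gap_rate by blast
  qed (rule pos \<theta>' M \<theta>)+
qed

end
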